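(* Let $\mathcal{F}$ denote the class of countable forests. Then $$\mathcal{F}_{\mathrm{/E}}=\mathrm{Forb}\left(\omega\cdot K_3,\ \bigvee K_3\right)=\mathcal{F}_{\mathrm{E/E}}.$$
   Context: All graphs are countable and simple; when edges are contracted, loops and parallel edges arising are discarded, so the result is again a simple graph. For a minor-closed class $\mathcal{C}$ of countable graphs: $\mathcal{C}_{\mathrm{E}}$ is the class of graphs $G$ such that by removing finitely many edges from $G$ one obtains a graph in $\mathcal{C}$; $\mathcal{C}_{\mathrm{/E}}$ is the class of graphs that belong to $\mathcal{C}$ after contracting finitely many edges; and $\mathcal{C}_{\mathrm{E/E}}:=(\mathcal{C}_{\mathrm{E}})_{\mathrm{/E}}=(\mathcal{C}_{\mathrm{/E}})_{\mathrm{E}}$. A graph $H$ is a minor of $G$ if there are pairwise disjoint non-empty connected subgraphs $B_v$ ($v\in V(H)$) of $G$ (branch sets, possibly infinite) and for each $uv\in E(H)$ an edge of $G$ between $B_u$ and $B_v$. For a set $X$ of graphs, $\mathrm{Forb}(X)$ is the class of (countable) graphs $H$ such that no element of $X$ is a minor of $H$. $\omega\cdot K_3$ is the disjoint union of countably infinitely many triangles; $\bigvee K_3$ is obtained from $\omega\cdot K_3$ by picking one vertex from each copy of $K_3$ and identifying all of them. *)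

theory Defs
  imports Main "HOL-Library.Countable_Set"
begin

record 'a graph =
  verts :: "'a set"
  edges :: "'a set set"

definition simple_graph :: "'a graph \<Rightarrow> bool" where
  "simple_graph G \<longleftrightarrow> (\<forall>e\<in>edges G. e \<subseteq> verts G \<and> card e = 2)"

definition countable_graph :: "'a graph \<Rightarrow> bool" where
  "countable_graph G \<longleftrightarrow> simple_graph G \<and> countable (verts G)"

definition subgraph :: "'a graph \<Rightarrow> 'a graph \<Rightarrow> bool" where
  "subgraph H G \<longleftrightarrow> simple_graph H \<and> verts H \<subseteq> verts G \<and> edges H \<subseteq> edges G"

definition reach :: "'a set set \<Rightarrow> ('a \<times> 'a) set" where
  "reach F = {(u, v). {u, v} \<in> F}\<^sup>*"

definition connected_graph :: "'a graph \<Rightarrow> bool" where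
  "connected_graph G \<longleftrightarrow> (\<forall>u\<in>verts G. \<forall>v\<in>verts G. (u, v) \<in> reach (edges G))"

definition is_cycle :: "'a graph \<Rightarrow> 'a list \<Rightarrow> bool" where
  "is_cycle G vs \<longleftrightarrow> 3 \<le> length vs \<and> distinct vs \<and>
     (\<forall>i<length vs. {vs ! i, vs ! (Suc i mod length vs)} \<in> edges G)"

definition forests :: "'a graph set" where
  "forests = {G. countable_graph G \<and> (\<nexists>vs. is_cycle G vs)}"

definition delete_edges :: "'a graph \<Rightarrow> 'a set set \<Rightarrow> 'a graph" where
  "delete_edges G D = \<lparr>verts = verts G, edges = edges G - D\<rparr>"

text \<open>The vertices of the contracted graph are the connected components of the
  spanning subgraph with edge set \<open>F\<close>, as sets of vertices of the original graph.\<close>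

definition contract_edges :: "'a graph \<Rightarrow> 'a set set \<Rightarrow> 'a set graph" where
  "contract_edges G F =
     \<lparr>verts = (\<lambda>v. reach F `` {v}) ` verts G,
      edges = {{reach F `` {u}, reach F `` {v}} |u v.
                 {u, v} \<in> edges G \<and> reach F `` {u} \<noteq> reach F `` {v}}\<rparr>"

text \<open>A class of graphs is given by a set of graphs over each vertex type. As contraction
  turns vertices into sets of vertices, the class of graphs over \<open>'a\<close> that lie in
  \<open>\<C>\<close> after a contraction is determined by the members of \<open>\<C>\<close> over \<open>'a set\<close>.\<close>

definition fin_delete :: "'a graph set \<Rightarrow> 'a graph set" where
  "fin_delete \<C> = {G. countable_graph G \<and>
     (\<exists>D. finite D \<and> D \<subseteq> edges G \<and> delete_edges G D \<in> \<C>)}"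

definition fin_contract :: "'a set graph set \<Rightarrow> 'a graph set" where
  "fin_contract \<C> = {G. countable_graph G \<and>
     (\<exists>F. finite F \<and> F \<subseteq> edges G \<and> contract_edges G F \<in> \<C>)}"

definition fin_delete_contract :: "'a set graph set \<Rightarrow> 'a graph set" where
  "fin_delete_contract \<C> = fin_contract (fin_delete \<C>)"

definition is_minor :: "'b graph \<Rightarrow> 'a graph \<Rightarrow> bool" where
  "is_minor H G \<longleftrightarrow> (\<exists>B :: 'b \<Rightarrow> 'a graph.
     (\<forall>v\<in>verts H. subgraph (B v) G \<and> verts (B v) \<noteq> {} \<and> connected_graph (B v)) \<and>
     (\<forall>u\<in>verts H. \<forall>v\<in>verts H. u \<noteq> v \<longrightarrow> verts (B u) \<inter> verts (B v) = {}) \<and>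
     (\<forall>u v. {u, v} \<in> edges H \<longrightarrow>
        (\<exists>x\<in>verts (B u). \<exists>y\<in>verts (B v). {x, y} \<in> edges G)))"

definition Forb :: "'b graph set \<Rightarrow> 'a graph set" where
  "Forb X = {G. countable_graph G \<and> (\<forall>H\<in>X. \<not> is_minor H G)}"

definition omega_K3 :: "(nat \<times> nat) graph" where
  "omega_K3 = \<lparr>verts = UNIV \<times> {..<3},
               edges = {{(n, i), (n, j)} |n i j. i < 3 \<and> j < 3 \<and> i \<noteq> j}\<rparr>"

definition image_graph :: "('a \<Rightarrow> 'b) \<Rightarrow> 'a graph \<Rightarrow> 'b graph" where
  "image_graph f G = \<lparr>verts = f ` verts G, edges = (\<lambda>e. f ` e) ` edges G\<rparr>"

text \<open>The vertices \<open>(n, 0)\<close>, one from each triangle, are all identified with \<open>(0, 0)\<close>.\<close>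

definition vee_K3 :: "(nat \<times> nat) graph" where
  "vee_K3 = image_graph (\<lambda>(n, i). if i = 0 then (0, 0) else (n, i)) omega_K3"

lemma countable_graph_omega_K3: "countable_graph omega_K3"
  by (auto simp: countable_graph_def simple_graph_def omega_K3_def card_insert_if)

lemma countable_graph_vee_K3: "countable_graph vee_K3"
proof -
  let ?f = "\<lambda>(n :: nat, i :: nat). if i = 0 then (0, 0) else (n, i)"
  have e: "?f ` e \<subseteq> ?f ` verts omega_K3 \<and> card (?f ` e) = 2"
    if "e \<in> edges omega_K3" for e
  proof
    show "?f ` e \<subseteq> ?f ` verts omega_K3"
      using that by (intro image_mono) (auto simp: omega_K3_def)
    show "card (?f ` e) = 2"
      using that by (auto simp: omega_K3_def card_insert_if)
  qed
  have "countable (verts omega_K3)" using countable_graph_omega_K3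
    by (simp add: countable_graph_def)
  then show ?thesis
    unfolding countable_graph_def simple_graph_def vee_K3_def image_graph_def graph.simps
    using e by (intro conjI countable_image ballI) blast+
qed

lemma edges_contract:
  assumes "simple_graph G"
  shows "edges (contract_edges G F) =
    {e' \<in> (\<lambda>e. (\<lambda>v. reach F `` {v}) ` e) ` edges G. card e' = 2}"
proof -
  have "e \<in> edges G \<Longrightarrow> \<exists>u v. e = {u, v}" for e
    using assms by (metis simple_graph_def card_2_iff)
  then show ?thesis
    by (fastforce simp: contract_edges_def card_insert_if image_iff split: if_splits)
qed

lemma countable_graph_contract:
  assumes "countable_graph G"
  shows "countable_graph (contract_edges G F)"
proof -
  have "{u, v} \<in> edges G \<Longrightarrow> u \<in> verts G \<and> v \<in> verts G" for u v
    using assms by (auto simp: countable_graph_def simple_graph_def)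
  with assms show ?thesis
    by (auto simp: countable_graph_def simple_graph_def contract_edges_def card_insert_if)
qed

lemma countable_graph_delete: "countable_graph G \<Longrightarrow> countable_graph (delete_edges G D)"
  by (auto simp: countable_graph_def simple_graph_def delete_edges_def)

lemma mem_reach_self: "v \<in> reach F `` {v}"
  by (simp add: reach_def)

lemma finite_reach_class:
  assumes "finite F" "\<And>e. e \<in> F \<Longrightarrow> finite e"
  shows "finite (reach F `` {v})"
proof -
  have "(v, w) \<in> reach F \<Longrightarrow> w \<in> insert v (\<Union>F)" for w
    unfolding reach_def by (induction rule: rtrancl_induct) auto
  then have "reach F `` {v} \<subseteq> insert v (\<Union>F)" by auto
  then show ?thesis by (rule finite_subset) (use assms in auto)
qed

lemma reach_class_eq:
  assumes "{a, b} \<in> F" shows "reach F `` {a} = reach F `` {b}"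
proof -
  have "(a, b) \<in> reach F" "(b, a) \<in> reach F"
    using assms by (auto simp: reach_def insert_commute)
  then show ?thesis
    by (auto simp: reach_def intro: rtrancl_trans)
qed

text \<open>The two orders of deletion and contraction give the same class.\<close>

lemma fin_delete_contract_commute: "fin_delete_contract \<C> = fin_delete (fin_contract \<C>)"
proof (intro set_eqI iffI)
  fix G assume "G \<in> fin_delete (fin_contract \<C>)"
  then obtain D F where G: "countable_graph G" and D: "finite D" "D \<subseteq> edges G"
    and F: "finite F" "F \<subseteq> edges G - D"
    and C: "contract_edges (delete_edges G D) F \<in> \<C>"
    by (auto simp: fin_delete_def fin_contract_def delete_edges_def)
  let ?p = "\<lambda>e. (\<lambda>v. reach F `` {v}) ` e"
  define D2 where "D2 = edges (contract_edges G F) - edges (contract_edges (delete_edges G D) F)"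
  have s: "simple_graph G" "simple_graph (delete_edges G D)"
    using G countable_graph_delete by (auto simp: countable_graph_def)
  have "D2 \<subseteq> ?p ` D"
    unfolding D2_def edges_contract[OF s(1)] edges_contract[OF s(2)]
    by (auto simp: delete_edges_def)
  then have fin: "finite D2" using D(1) by (meson finite_imageI finite_subset)
  have sub: "edges (contract_edges (delete_edges G D) F) \<subseteq> edges (contract_edges G F)"
    unfolding edges_contract[OF s(1)] edges_contract[OF s(2)] by (auto simp: delete_edges_def)
  have "delete_edges (contract_edges G F) D2 = contract_edges (delete_edges G D) F"
    using sub by (auto simp: delete_edges_def[of "contract_edges G F"] D2_def double_diff)
      (simp add: contract_edges_def delete_edges_def)
  with C fin have "contract_edges G F \<in> fin_delete \<C>"
    by (auto simp: fin_delete_def D2_def intro!: countable_graph_contract[OF G] exI[of _ D2])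
  with G F show "G \<in> fin_delete_contract \<C>"
    by (auto simp: fin_delete_contract_def fin_contract_def)
next
  fix G assume "G \<in> fin_delete_contract \<C>"
  then obtain D F where G: "countable_graph G" and F: "finite F" "F \<subseteq> edges G"
    and D: "finite D" "D \<subseteq> edges (contract_edges G F)"
    and C: "delete_edges (contract_edges G F) D \<in> \<C>"
    by (auto simp: fin_delete_contract_def fin_delete_def fin_contract_def)
  let ?p = "\<lambda>e. (\<lambda>v. reach F `` {v}) ` e"
  define D' where "D' = {e \<in> edges G. ?p e \<in> D}"
  have s: "simple_graph G" "simple_graph (delete_edges G D')"
    using G countable_graph_delete by (auto simp: countable_graph_def)
  have two: "\<exists>a b. e = {a, b}" if "e \<in> edges G" for e
    using s(1) that by (metis simple_graph_def card_2_iff)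
  have finE: "finite e" if "e \<in> edges G" for e
    using two[OF that] by auto
  have "finite c" if "e \<in> D" "c \<in> e" for e c
  proof -
    have "e \<in> edges (contract_edges G F)" using that D(2) by blast
    then obtain v where "c = reach F `` {v}"
      using \<open>c \<in> e\<close> by (auto simp: edges_contract[OF s(1)])
    then show ?thesis using finite_reach_class[of F v] F finE by auto
  qed
  moreover have "finite e" if "e \<in> D" for e
  proof -
    have "card e = 2" using that D(2) by (auto simp: edges_contract[OF s(1)])
    then show ?thesis by (metis card.infinite zero_neq_numeral)
  qed
  ultimately have "finite (\<Union>(\<Union>D))" using D(1) by auto
  moreover have "D' \<subseteq> Pow (\<Union>(\<Union>D))"
  proof (intro subsetI PowI)
    fix e w assume "e \<in> D'" "w \<in> e"
    then have "reach F `` {w} \<in> ?p e" "?p e \<in> D" by (auto simp: D'_def)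
    then show "w \<in> \<Union>(\<Union>D)" using mem_reach_self[of w F] by blast
  qed
  ultimately have fin: "finite D'" by (meson finite_Pow_iff finite_subset)
  have "F \<inter> D' = {}"
  proof (rule ccontr)
    assume "F \<inter> D' \<noteq> {}"
    then obtain e where e: "e \<in> F" "?p e \<in> D" by (auto simp: D'_def)
    obtain a b where ab: "e = {a, b}" using e F two by blast
    have "?p e = {reach F `` {a}}" using reach_class_eq[of a b F] e ab by auto
    moreover have "card (?p e) = 2" using e(2) D(2) by (auto simp: edges_contract[OF s(1)])
    ultimately show False by simp
  qed
  then have F': "F \<subseteq> edges (delete_edges G D')" using F by (auto simp: delete_edges_def)
  have "edges (contract_edges (delete_edges G D') F) = edges (contract_edges G F) - D"
    unfolding edges_contract[OF s(1)] edges_contract[OF s(2)]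
    by (auto simp: delete_edges_def D'_def)
  then have "contract_edges (delete_edges G D') F = delete_edges (contract_edges G F) D"
    by (auto simp: delete_edges_def[of "contract_edges G F"])
      (simp add: contract_edges_def delete_edges_def)
  with C F F' have "delete_edges G D' \<in> fin_contract \<C>"
    by (auto simp: fin_contract_def intro!: countable_graph_delete[OF G] exI[of _ F])
  with G fin show "G \<in> fin_delete (fin_contract \<C>)"
    by (auto simp: fin_delete_def D'_def intro!: exI[of _ D'])
qed

end

theory Submission
  imports Defs
begin

text \<open>
  One inclusion is the survival of a cycle. Suppose that deleting a finite set \<open>D\<close> and contracting a
  finite set \<open>F\<close> turns \<open>G\<close> into a forest, and that \<open>G\<close> has infinitely many disjoint triangles as a
  minor, or infinitely many triangles sharing one branch set. Almost all of the private branch sets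
  avoid the finitely many vertices touched by \<open>D\<close> and \<open>F\<close>. For disjoint triangles, one that is
  avoided entirely survives. For triangles sharing a centre, deleting \<open>D\<close> cuts the centre into
  finitely many pieces, so two untouched triangles attach to the same two pieces, and together they
  contain a cycle that survives.

  The other inclusion constructs a finite set \<open>Z\<close> of vertices such that contracting all edges inside
  \<open>Z\<close> leaves a forest. Call two distinct vertices that are both adjacent to \<open>Z\<close> and joined by a path
  avoiding \<open>Z\<close> the ends of an ear of \<open>Z\<close>. If \<open>Z\<close> is finite and connected inside each component of
  \<open>G\<close>, then infinitely many disjoint ears would give \<open>\<Or>K\<^sub>3\<close> as a minor: infinitely many of
  them start at the same vertex of \<open>Z\<close>, and the part of \<open>Z\<close> around it serves as the centre. Hence
  finitely many vertices meet all ears of \<open>Z\<close> (\<open>finite_ear_hitting_set\<close>); likewise, as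
  \<open>\<omega> \<cdot> K\<^sub>3\<close> is not a minor, finitely many vertices meet all cycles
  (\<open>finite_cycle_hitting_set\<close>).

  If such a \<open>Z\<close> has no ears at all and \<open>G - Z\<close> is a forest, then the contraction is a forest
  (\<open>acyc_contract_earless\<close>): a cycle through a contracted vertex would come from an ear. Hitting
  all ears and enlarging \<open>Z\<close> is not enough to reach this state, because the added vertices create new
  ears. It takes two rounds (\<open>finite_earless_set\<close>). The first round produces a set \<open>Z\<close> for which
  every component of \<open>G - Z\<close> has only finitely many neighbours of \<open>Z\<close>: each old vertex of \<open>Z\<close>
  contributes at most one as the old ears have been hit, and each new vertex contributes at most one
  as it belonged to a forest. Only finitely many components contain an ear of \<open>Z\<close>, as those ears have
  a finite hitting set too, so there are finitely many ends of ears in all. The second round adds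
  these ends together with paths connecting those that lie in the same component. A remaining ear
  would then close a cycle with one of these paths inside a forest.
\<close>

section \<open>Reachability and connected vertex sets\<close>

definition induced :: "'a set set \<Rightarrow> 'a set \<Rightarrow> 'a set set" where
  "induced E S = {e \<in> E. e \<subseteq> S}"

definition conn :: "'a set set \<Rightarrow> 'a set \<Rightarrow> bool" where
  "conn E S \<longleftrightarrow> (\<forall>u\<in>S. \<forall>v\<in>S. (u, v) \<in> reach (induced E S))"

definition adj :: "'a set set \<Rightarrow> 'a set \<Rightarrow> 'a set \<Rightarrow> bool" where
  "adj E A B \<longleftrightarrow> (\<exists>a\<in>A. \<exists>b\<in>B. {a, b} \<in> E)"

lemma reach_refl [simp]: "(v, v) \<in> reach F"
  by (simp add: reach_def)

lemma reach_edge: "{u, v} \<in> F \<Longrightarrow> (u, v) \<in> reach F"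
  by (auto simp: reach_def)

lemma reach_trans [trans]: "(u, v) \<in> reach F \<Longrightarrow> (v, w) \<in> reach F \<Longrightarrow> (u, w) \<in> reach F"
  by (auto simp: reach_def)

lemma reach_sym: "(u, v) \<in> reach F \<Longrightarrow> (v, u) \<in> reach F"
proof -
  have "sym {(u, v). {u, v} \<in> F}" by (auto simp: sym_def insert_commute)
  then show "(u, v) \<in> reach F \<Longrightarrow> (v, u) \<in> reach F"
    unfolding reach_def by (meson sym_rtrancl symD)
qed

lemma reach_mono: "(u, v) \<in> reach F \<Longrightarrow> F \<subseteq> F' \<Longrightarrow> (u, v) \<in> reach F'"
  unfolding reach_def by (erule rev_subsetD, rule rtrancl_mono) auto

lemma reach_induct [consumes 1, case_names refl step]:
  assumes "(u, v) \<in> reach F" "P u"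
    "\<And>x y. (u, x) \<in> reach F \<Longrightarrow> {x, y} \<in> F \<Longrightarrow> P x \<Longrightarrow> P y"
  shows "P v"
  using assms(1) unfolding reach_def
  by (induction rule: rtrancl_induct) (use assms(2,3) in \<open>auto simp: reach_def\<close>)

lemma reach_class_eq_iff: "reach F `` {u} = reach F `` {v} \<longleftrightarrow> (u, v) \<in> reach F"
  by (auto intro: reach_trans reach_sym)

lemma reach_in_Union: "(u, v) \<in> reach F \<Longrightarrow> v = u \<or> v \<in> \<Union>F \<and> u \<in> \<Union>F"
proof (induction rule: reach_induct)
  case (step x y)
  then show ?case by blast
qed simp

lemma induced_mono: "E \<subseteq> E' \<Longrightarrow> S \<subseteq> S' \<Longrightarrow> induced E S \<subseteq> induced E' S'"
  by (auto simp: induced_def)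

lemma reach_induced: "(u, v) \<in> reach (induced E S) \<Longrightarrow> v = u \<or> v \<in> S \<and> u \<in> S"
  using reach_in_Union[of u v "induced E S"] by (auto simp: induced_def)

lemma reach_induced_mono:
  "(u, v) \<in> reach (induced E S) \<Longrightarrow> E \<subseteq> E' \<Longrightarrow> S \<subseteq> S' \<Longrightarrow> (u, v) \<in> reach (induced E' S')"
  by (meson reach_mono induced_mono)

lemma reach_induced_D: "(u, v) \<in> reach (induced E S) \<Longrightarrow> (u, v) \<in> reach E"
  by (erule reach_mono) (auto simp: induced_def)

lemma conn_singleton: "conn E {v}"
  by (simp add: conn_def)

lemma conn_mono: "conn E S \<Longrightarrow> E \<subseteq> E' \<Longrightarrow> conn E' S"
  unfolding conn_def by (meson reach_induced_mono subset_refl)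

lemma conn_insert:
  assumes "conn E S" "x \<in> S" "{x, y} \<in> E"
  shows "conn E (insert y S)"
proof -
  have *: "(x, u) \<in> reach (induced E (insert y S))" if "u \<in> insert y S" for u
  proof (cases "u \<in> S")
    case True
    then show ?thesis using assms unfolding conn_def
      by (meson reach_induced_mono subset_insertI subset_refl)
  next
    case False
    with that show ?thesis using assms by (intro reach_edge) (auto simp: induced_def)
  qed
  show ?thesis unfolding conn_def using * by (meson reach_trans reach_sym)
qed

lemma conn_reach_class:
  assumes "E' \<subseteq> E"
  shows "conn E (reach E' `` {z})"
proof -
  have "(z, w) \<in> reach (induced E (reach E' `` {z}))" if "(z, w) \<in> reach E'" for w
    using that
  proof (induction rule: reach_induct)
    case (step x y)
    have "(z, y) \<in> reach E'" using step reach_trans reach_edge by meson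
    then have "{x, y} \<in> induced E (reach E' `` {z})"
      using step assms by (auto simp: induced_def)
    then show ?case using step by (meson reach_edge reach_trans)
  qed simp
  then show ?thesis unfolding conn_def by (meson Image_singleton_iff reach_sym reach_trans)
qed

lemma reach_finite_conn:
  assumes "(x, q) \<in> reach E"
  obtains V where "finite V" "conn E V" "x \<in> V" "q \<in> V" "V \<subseteq> insert x (\<Union>E)"
proof -
  have "\<exists>V. finite V \<and> conn E V \<and> x \<in> V \<and> q \<in> V \<and> V \<subseteq> insert x (\<Union>E)"
    using assms
  proof (induction rule: reach_induct)
    case refl
    show ?case by (rule exI[of _ "{x}"]) (simp add: conn_singleton)
  next
    case (step u v)
    then obtain V where "finite V" "conn E V" "x \<in> V" "u \<in> V" "V \<subseteq> insert x (\<Union>E)"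
      by blast
    with step show ?case by (intro exI[of _ "insert v V"]) (auto intro: conn_insert)
  qed
  then show thesis using that by blast
qed

text \<open>Cutting a walk at its last visit of \<open>p\<close>.\<close>

lemma reach_first_step:
  assumes "(p, q) \<in> reach E" "p \<noteq> q"
  obtains x where "x \<noteq> p" "{p, x} \<in> E" "(x, q) \<in> reach {e \<in> E. p \<notin> e}"
proof -
  have "q = p \<or> (\<exists>x. x \<noteq> p \<and> {p, x} \<in> E \<and> (x, q) \<in> reach {e \<in> E. p \<notin> e})"
    using assms(1)
  proof (induction rule: reach_induct)
    case (step u v)
    show ?case
    proof (cases "v = p \<or> u = p")
      case True
      then show ?thesis using step by (cases "v = p") auto
    next
      case False
      then have "{u, v} \<in> {e \<in> E. p \<notin> e}" using step by auto
      then show ?thesis using step False by (meson reach_edge reach_trans)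
    qed
  qed simp
  then show thesis using that assms(2) by blast
qed

text \<open>This replaces simple paths: a path from \<open>p\<close> to \<open>q\<close> is split into its first vertex and a finite
  connected rest, which are the two branch sets that triangle minors need.\<close>

lemma path_split_first:
  assumes "(p, q) \<in> reach E" "p \<noteq> q"
  obtains x V where "{p, x} \<in> E" "x \<in> V" "q \<in> V" "p \<notin> V" "finite V" "conn E V" "V \<subseteq> \<Union>E"
proof -
  obtain x where x: "x \<noteq> p" "{p, x} \<in> E" "(x, q) \<in> reach {e \<in> E. p \<notin> e}"
    using reach_first_step[OF assms] by blast
  obtain V where V: "finite V" "conn {e \<in> E. p \<notin> e} V" "x \<in> V" "q \<in> V"
      "V \<subseteq> insert x (\<Union>{e \<in> E. p \<notin> e})"
    using reach_finite_conn[OF x(3)] by blast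
  have "conn E V" using V(2) by (rule conn_mono) auto
  moreover have "V \<subseteq> \<Union>E" "p \<notin> V" using V(5) x by auto
  ultimately show thesis using that x V by blast
qed

text \<open>Either a walk avoids \<open>Z\<close>, or it has an initial part that avoids \<open>Z\<close> and ends at a neighbour
  \<open>p\<close> of \<open>Z\<close>. Such vertices \<open>p\<close> are the candidates for ends of ears.\<close>

lemma reach_first_hit:
  assumes "(a, c) \<in> reach E" "a \<notin> Z"
  shows "(a, c) \<in> reach (induced E (- Z)) \<or>
    (\<exists>p z. (a, p) \<in> reach (induced E (- Z)) \<and> {p, z} \<in> E \<and> p \<notin> Z \<and> z \<in> Z)"
  using assms(1)
proof (induction rule: reach_induct)
  case (step x y)
  show ?case
  proof (cases "(a, x) \<in> reach (induced E (- Z))")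
    case True
    then have "x \<notin> Z" using reach_induced[OF True] assms(2) by auto
    show ?thesis
    proof (cases "y \<in> Z")
      case True
      then show ?thesis using \<open>(a, x) \<in> reach (induced E (- Z))\<close> step \<open>x \<notin> Z\<close> by blast
    next
      case False
      then have "{x, y} \<in> induced E (- Z)" using step \<open>x \<notin> Z\<close> by (auto simp: induced_def)
      then show ?thesis using True by (meson reach_edge reach_trans)
    qed
  next
    case False
    then show ?thesis using step by blast
  qed
qed simp

section \<open>Forests as graphs in which every edge is a bridge\<close>

text \<open>Acyclicity as the absence of edges whose ends stay connected without them. Unlike cycles given
  as lists of vertices, this passes through contractions by mere transport of reachability.\<close>

definition acyc :: "'a set set \<Rightarrow> bool" where
  "acyc E \<longleftrightarrow> (\<forall>a b. {a, b} \<in> E \<longrightarrow> a \<noteq> b \<longrightarrow> (a, b) \<notin> reach (E - {{a, b}}))"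

lemma acycD: "acyc E \<Longrightarrow> {a, b} \<in> E \<Longrightarrow> a \<noteq> b \<Longrightarrow> (a, b) \<in> reach (E - {{a, b}}) \<Longrightarrow> False"
  by (auto simp: acyc_def)

lemma acyc_mono: "acyc E \<Longrightarrow> E' \<subseteq> E \<Longrightarrow> acyc E'"
  unfolding acyc_def by (meson Diff_mono reach_mono subset_iff subset_refl)

lemma reach_distinct_path:
  assumes "(x, q) \<in> reach E"
  obtains xs where "xs \<noteq> []" "hd xs = x" "last xs = q" "distinct xs"
    "\<And>i. Suc i < length xs \<Longrightarrow> {xs ! i, xs ! Suc i} \<in> E"
proof -
  have "\<exists>xs. xs \<noteq> [] \<and> hd xs = x \<and> last xs = q \<and> distinct xs \<and>
      (\<forall>i. Suc i < length xs \<longrightarrow> {xs ! i, xs ! Suc i} \<in> E)"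
    using assms
  proof (induction rule: reach_induct)
    case refl
    show ?case by (rule exI[of _ "[x]"]) auto
  next
    case (step u v)
    then obtain xs where xs: "xs \<noteq> []" "hd xs = x" "last xs = u" "distinct xs"
      "\<forall>i. Suc i < length xs \<longrightarrow> {xs ! i, xs ! Suc i} \<in> E" by blast
    show ?case
    proof (cases "v \<in> set xs")
      case True
      then obtain k where k: "k < length xs" "xs ! k = v" by (auto simp: in_set_conv_nth)
      then have "last (take (Suc k) xs) = v" by (simp add: take_Suc_conv_app_nth)
      then show ?thesis using xs k by (intro exI[of _ "take (Suc k) xs"]) auto
    next
      case False
      have "{(xs @ [v]) ! i, (xs @ [v]) ! Suc i} \<in> E" if "Suc i < length (xs @ [v])" for i
      proof (cases "Suc i < length xs")
        case True
        then show ?thesis using xs by (simp add: nth_append)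
      next
        case False
        then have "Suc i = length xs" using that by simp
        then have "i = length xs - 1" by simp
        then show ?thesis using \<open>Suc i = length xs\<close> xs(1,3) step(2)
          by (auto simp: nth_append last_conv_nth)
      qed
      then show ?thesis using xs False by (intro exI[of _ "xs @ [v]"]) auto
    qed
  qed
  then show thesis using that by blast
qed

text \<open>A distinct path between the ends of a non-bridge \<open>{a, b}\<close> that does not use it has at least
  three vertices, so closing it up with \<open>{a, b}\<close> gives a cycle.\<close>

lemma cycle_if_not_acyc:
  assumes "\<not> acyc (edges G)"
  shows "\<exists>vs. is_cycle G vs"
proof -
  obtain a b where ab: "{a, b} \<in> edges G" "a \<noteq> b" "(a, b) \<in> reach (edges G - {{a, b}})"
    using assms by (auto simp: acyc_def)
  obtain xs where xs: "xs \<noteq> []" "hd xs = a" "last xs = b" "distinct xs"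
    "\<And>i. Suc i < length xs \<Longrightarrow> {xs ! i, xs ! Suc i} \<in> edges G - {{a, b}}"
    using reach_distinct_path[OF ab(3)] by blast
  have nth: "xs ! 0 = a" "xs ! (length xs - 1) = b"
    using xs by (auto simp: hd_conv_nth last_conv_nth)
  have "length xs \<noteq> 1" using nth ab(2) by auto
  moreover have "length xs \<noteq> 2" using xs(5)[of 0] nth by (auto simp: numeral_2_eq_2)
  moreover have "length xs \<noteq> 0" using xs(1) by simp
  ultimately have len: "3 \<le> length xs" by linarith
  have "{xs ! i, xs ! (Suc i mod length xs)} \<in> edges G" if "i < length xs" for i
  proof (cases "Suc i < length xs")
    case True
    then show ?thesis using xs(5) by simp
  next
    case False
    then have "Suc i = length xs" using that by simp
    then have "i = length xs - 1" "Suc i mod length xs = 0" by auto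
    then show ?thesis using nth ab(1) by (simp add: insert_commute)
  qed
  then show ?thesis using len xs(4) by (auto simp: is_cycle_def)
qed

lemma not_acyc_if_cycle:
  assumes "is_cycle G vs"
  shows "\<not> acyc (edges G)"
proof
  assume ac: "acyc (edges G)"
  let ?n = "length vs"
  have n: "3 \<le> ?n" and d: "distinct vs"
    and e: "\<And>i. i < ?n \<Longrightarrow> {vs ! i, vs ! (Suc i mod ?n)} \<in> edges G"
    using assms by (auto simp: is_cycle_def)
  let ?E = "edges G - {{vs ! 0, vs ! (?n - 1)}}"
  have nth: "vs ! i = vs ! j \<longleftrightarrow> i = j" if "i < ?n" "j < ?n" for i j
    using d that by (simp add: nth_eq_iff_index_eq)
  have "(vs ! 0, vs ! i) \<in> reach ?E" if "i < ?n" for i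
    using that
  proof (induction i)
    case (Suc i)
    have "{vs ! i, vs ! Suc i} \<in> edges G" using e[of i] Suc.prems by simp
    moreover have "{vs ! i, vs ! Suc i} \<noteq> {vs ! 0, vs ! (?n - 1)}"
    proof
      assume "{vs ! i, vs ! Suc i} = {vs ! 0, vs ! (?n - 1)}"
      then consider "vs ! i = vs ! 0" "vs ! Suc i = vs ! (?n - 1)"
        | "vs ! Suc i = vs ! 0" by (auto simp: doubleton_eq_iff)
      then have "i = 0 \<and> Suc i = ?n - 1"
        using nth[of i 0] nth[of "Suc i" 0] nth[of "Suc i" "?n - 1"] Suc.prems n
        by cases linarith+
      then show False using n by auto
    qed
    ultimately have "(vs ! i, vs ! Suc i) \<in> reach ?E" by (intro reach_edge) auto
    then show ?case using Suc by (meson Suc_lessD reach_trans)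
  qed simp
  then have "(vs ! 0, vs ! (?n - 1)) \<in> reach ?E" using n by simp
  moreover have "{vs ! 0, vs ! (?n - 1)} \<in> edges G"
  proof -
    have "Suc (?n - 1) = ?n" using n by simp
    then have "Suc (?n - 1) mod ?n = 0" by simp
    then show ?thesis using e[of "?n - 1"] n by (simp add: insert_commute)
  qed
  moreover have "vs ! 0 \<noteq> vs ! (?n - 1)"
  proof -
    have "0 < ?n" "?n - 1 < ?n" "0 \<noteq> ?n - 1" using n by linarith+
    then show ?thesis using nth by blast
  qed
  ultimately show False using acycD[OF ac] by blast
qed

lemma forests_iff_acyc: "G \<in> forests \<longleftrightarrow> countable_graph G \<and> acyc (edges G)"
  unfolding forests_def using cycle_if_not_acyc not_acyc_if_cycle by blast

text \<open>Splitting off the first two vertices of a cycle leaves a connected set adjacent to both. That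
  this set is finite matters later: only finite triangles can be chosen greedily to be disjoint.\<close>

lemma triangle_if_not_acyc:
  assumes "\<not> acyc E"
  obtains a x V where "finite V" "conn E V" "a \<notin> V" "x \<notin> V" "a \<noteq> x" "V \<noteq> {}"
    "{a, x} \<in> E" "adj E {x} V" "adj E {a} V" "insert a (insert x V) \<subseteq> \<Union>E"
proof -
  obtain a b where ab: "{a, b} \<in> E" "a \<noteq> b" "(a, b) \<in> reach (E - {{a, b}})"
    using assms by (auto simp: acyc_def)
  obtain x V where x: "{a, x} \<in> E - {{a, b}}" "x \<in> V" "b \<in> V" "a \<notin> V" "finite V"
      "conn (E - {{a, b}}) V" "V \<subseteq> \<Union>(E - {{a, b}})"
    using path_split_first[OF ab(3,2)] by blast
  have "x \<noteq> b" using x by auto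
  moreover have "(x, b) \<in> reach (induced E V)"
    using x unfolding conn_def by (meson Diff_subset reach_induced_mono subset_refl)
  ultimately obtain y U where y: "{x, y} \<in> induced E V" "y \<in> U" "b \<in> U" "x \<notin> U" "finite U"
      "conn (induced E V) U" "U \<subseteq> \<Union>(induced E V)"
    using path_split_first by metis
  have "U \<subseteq> V" using y(7) by (auto simp: induced_def)
  moreover have "conn E U" using y(6) by (rule conn_mono) (auto simp: induced_def)
  ultimately show thesis using x y ab
    by (intro that[of U a x]) (auto simp: adj_def induced_def)
qed

section \<open>Minors by connected vertex sets\<close>

lemma adj_sym: "adj E A B \<Longrightarrow> adj E B A"
  unfolding adj_def by (metis insert_commute)

lemma simple_edges_subset: "simple_graph G \<Longrightarrow> \<Union>(edges G) \<subseteq> verts G"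
  by (auto simp: simple_graph_def)

text \<open>Branch sets may be taken to be induced subgraphs, so that only their vertex sets matter.\<close>

lemma is_minor_iff:
  assumes G: "simple_graph G"
  shows "is_minor H G \<longleftrightarrow> (\<exists>S.
     (\<forall>v\<in>verts H. S v \<subseteq> verts G \<and> S v \<noteq> {} \<and> conn (edges G) (S v)) \<and>
     (\<forall>u\<in>verts H. \<forall>v\<in>verts H. u \<noteq> v \<longrightarrow> S u \<inter> S v = {}) \<and>
     (\<forall>u v. {u, v} \<in> edges H \<longrightarrow> adj (edges G) (S u) (S v)))" (is "_ \<longleftrightarrow> (\<exists>S. ?P S)")
proof
  assume "is_minor H G"
  then obtain B where
    B: "\<And>v. v \<in> verts H \<Longrightarrow> subgraph (B v) G \<and> verts (B v) \<noteq> {} \<and> connected_graph (B v)"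
      "\<And>u v. u \<in> verts H \<Longrightarrow> v \<in> verts H \<Longrightarrow> u \<noteq> v \<Longrightarrow> verts (B u) \<inter> verts (B v) = {}"
      "\<And>u v. {u, v} \<in> edges H \<Longrightarrow> \<exists>x\<in>verts (B u). \<exists>y\<in>verts (B v). {x, y} \<in> edges G"
    unfolding is_minor_def by (elim exE conjE) metis
  have "conn (edges G) (verts (B v))" if "v \<in> verts H" for v
  proof -
    have "edges (B v) \<subseteq> induced (edges G) (verts (B v))"
      using B(1)[OF that] by (auto simp: subgraph_def simple_graph_def induced_def)
    then show ?thesis using B(1)[OF that]
      unfolding conn_def connected_graph_def by (meson reach_mono)
  qed
  with B have "?P (\<lambda>v. verts (B v))" by (auto simp: subgraph_def adj_def)
  then show "\<exists>S. ?P S" by (rule exI[of _ "\<lambda>v. verts (B v)"])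
next
  assume "\<exists>S. ?P S"
  then obtain S where S: "?P S" by blast
  define B where "B v = \<lparr>verts = S v, edges = induced (edges G) (S v)\<rparr>" for v
  have "subgraph (B v) G \<and> verts (B v) \<noteq> {} \<and> connected_graph (B v)" if "v \<in> verts H" for v
    using S that G
    by (auto simp: B_def subgraph_def simple_graph_def connected_graph_def induced_def conn_def)
  with S show "is_minor H G"
    unfolding is_minor_def by (intro exI[of _ B]) (auto simp: B_def adj_def)
qed

lemma omega_K3_minorI:
  fixes A B C :: "nat \<Rightarrow> 'a set"
  assumes G: "simple_graph G"
    and sub: "\<And>n. A n \<union> B n \<union> C n \<subseteq> verts G"
    and ne: "\<And>n. A n \<noteq> {}" "\<And>n. B n \<noteq> {}" "\<And>n. C n \<noteq> {}"
    and conn: "\<And>n. conn (edges G) (A n)" "\<And>n. conn (edges G) (B n)" "\<And>n. conn (edges G) (C n)"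
    and disj: "\<And>n. A n \<inter> B n = {}" "\<And>n. B n \<inter> C n = {}" "\<And>n. A n \<inter> C n = {}"
    and disj': "\<And>m n. m \<noteq> n \<Longrightarrow> (A m \<union> B m \<union> C m) \<inter> (A n \<union> B n \<union> C n) = {}"
    and adj: "\<And>n. adj (edges G) (A n) (B n)" "\<And>n. adj (edges G) (B n) (C n)"
      "\<And>n. adj (edges G) (A n) (C n)"
  shows "is_minor omega_K3 G"
proof -
  define S where "S = (\<lambda>(n, i::nat). if i = 0 then A n else if i = 1 then B n else C n)"
  have "S u \<subseteq> verts G \<and> S u \<noteq> {} \<and> conn (edges G) (S u)" for u
    using sub ne conn by (cases u) (auto simp: S_def)
  moreover have "S u \<inter> S v = {}" if uv: "u \<in> verts omega_K3" "v \<in> verts omega_K3" "u \<noteq> v" for u v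
  proof -
    obtain m i n j where [simp]: "u = (m, i)" "v = (n, j)" by fastforce
    show ?thesis
    proof (cases "m = n")
      case True
      have "i < 3" "j < 3" "i \<noteq> j" using uv True by (auto simp: omega_K3_def)
      then have "i \<in> {0, 1, 2}" "j \<in> {0, 1, 2}" by auto
      then show ?thesis using True \<open>i \<noteq> j\<close> disj[of n] by (auto simp: S_def)
    next
      case False
      have "S u \<subseteq> A m \<union> B m \<union> C m" "S v \<subseteq> A n \<union> B n \<union> C n" by (auto simp: S_def)
      then show ?thesis using disj'[OF False] by blast
    qed
  qed
  moreover have "adj (edges G) (S u) (S v)" if "{u, v} \<in> edges omega_K3" for u v
  proof -
    obtain n i j where "u = (n, i)" "v = (n, j)" and ij: "i < 3" "j < 3" "i \<noteq> j"
      using \<open>{u, v} \<in> edges omega_K3\<close> by (auto simp: omega_K3_def doubleton_eq_iff)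
    moreover have "i \<in> {0, 1, 2}" "j \<in> {0, 1, 2}" using ij by auto
    ultimately show ?thesis using adj[of n] by (auto simp: S_def intro: adj_sym)
  qed
  ultimately show ?thesis unfolding is_minor_iff[OF G] by blast
qed

lemma verts_vee_K3: "verts vee_K3 = insert (0, 0) (UNIV \<times> {1, 2})"
proof -
  have "{..<3::nat} = {0, 1, 2}" by auto
  then show ?thesis by (force simp: vee_K3_def image_graph_def omega_K3_def image_iff)
qed

lemma edges_vee_K3:
  "edges vee_K3 = (\<Union>n. {{(0, 0), (n, 1)}, {(0, 0), (n, 2)}, {(n, 1), (n, 2)}})"
proof -
  let ?f = "\<lambda>(n :: nat, i :: nat). if i = 0 then (0, 0) else (n, i)"
  have om: "edges omega_K3 = (\<Union>n. {{(n, 0), (n, 1)}, {(n, 0), (n, 2)}, {(n, 1), (n, 2)}})"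
  proof (intro equalityI subsetI)
    fix e assume "e \<in> edges omega_K3"
    then obtain n i j where e: "e = {(n, i), (n, j)}" and ij: "i < 3" "j < 3" "i \<noteq> j"
      by (auto simp: omega_K3_def)
    moreover have "i \<in> {0, 1, 2}" "j \<in> {0, 1, 2}" using ij by auto
    ultimately show "e \<in> (\<Union>n. {{(n, 0), (n, 1)}, {(n, 0), (n, 2)}, {(n, 1), (n, 2)}})"
      by (auto simp: insert_commute)
  next
    fix e :: "(nat \<times> nat) set"
    assume "e \<in> (\<Union>n. {{(n, 0), (n, 1)}, {(n, 0), (n, 2)}, {(n, 1), (n, 2)}})"
    then obtain n where "e \<in> {{(n, 0), (n, 1)}, {(n, 0), (n, 2)}, {(n, 1), (n, 2)}}" by blast
    moreover have "{(n, i), (n, j)} \<in> edges omega_K3" if "i < 3" "j < 3" "i \<noteq> j" for i j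
      using that unfolding omega_K3_def by auto
    ultimately show "e \<in> edges omega_K3" by auto
  qed
  show ?thesis by (simp add: vee_K3_def image_graph_def om image_UN)
qed

lemma vee_K3_minorI:
  fixes A B :: "nat \<Rightarrow> 'a set"
  assumes G: "simple_graph G"
    and sub: "W \<subseteq> verts G" "\<And>n. A n \<union> B n \<subseteq> verts G"
    and ne: "W \<noteq> {}" "\<And>n. A n \<noteq> {}" "\<And>n. B n \<noteq> {}"
    and conn: "conn (edges G) W" "\<And>n. conn (edges G) (A n)" "\<And>n. conn (edges G) (B n)"
    and disj: "\<And>n. A n \<inter> B n = {}" "\<And>n. W \<inter> (A n \<union> B n) = {}"
    and disj': "\<And>m n. m \<noteq> n \<Longrightarrow> (A m \<union> B m) \<inter> (A n \<union> B n) = {}"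
    and adj: "\<And>n. adj (edges G) (A n) (B n)" "\<And>n. adj (edges G) (A n) W"
      "\<And>n. adj (edges G) (B n) W"
  shows "is_minor vee_K3 G"
proof -
  define S where "S = (\<lambda>(n, i::nat). if i = 0 then W else if i = 1 then A n else B n)"
  have "S u \<subseteq> verts G \<and> S u \<noteq> {} \<and> conn (edges G) (S u)" for u
    using sub ne conn by (cases u) (auto simp: S_def)
  moreover have "S u \<inter> S v = {}" if uv: "u \<in> verts vee_K3" "v \<in> verts vee_K3" "u \<noteq> v" for u v
  proof -
    obtain m i n j where [simp]: "u = (m, i)" "v = (n, j)" by fastforce
    show ?thesis using uv disj[of m] disj[of n] disj'[of m n]
      by (cases "m = n") (auto simp: verts_vee_K3 S_def)
  qed
  moreover have "adj (edges G) (S u) (S v)" if uv: "{u, v} \<in> edges vee_K3" for u v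
    using uv adj by (auto simp: edges_vee_K3 doubleton_eq_iff S_def intro: adj_sym)
  ultimately show ?thesis unfolding is_minor_iff[OF G] by blast
qed

section \<open>Infinitely many triangles survive finitely many changes\<close>

text \<open>If \<open>F\<close> touches neither \<open>a\<close> nor \<open>b\<close>, their classes are singletons, so no other edge of \<open>G\<close> is
  mapped onto the image of \<open>{a, b}\<close>. A detour around \<open>{a, b}\<close> is therefore mapped to a detour around
  its image, even though contraction merges parallel edges.\<close>

lemma contracted_edge_not_bridge:
  assumes G: "simple_graph G" and ab: "{a, b} \<in> edges G" "a \<noteq> b" "a \<notin> \<Union>F" "b \<notin> \<Union>F"
    and r: "(a, b) \<in> reach (edges G - {{a, b}})"
  shows "\<not> acyc (edges (contract_edges G F))"
proof
  let ?c = "\<lambda>v. reach F `` {v}"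
  let ?E = "edges (contract_edges G F)"
  assume ac: "acyc ?E"
  have single: "?c w = {w}" if "w \<notin> \<Union>F" for w
  proof
    show "?c w \<subseteq> {w}" using that reach_in_Union[of w _ F] by blast
  qed simp
  have a: "?c a = {a}" and b: "?c b = {b}"
    using ab single by blast+
  have edge: "{?c u, ?c v} \<in> ?E" if "{u, v} \<in> edges G" "?c u \<noteq> ?c v" for u v
    using that by (auto simp: contract_edges_def)
  have eq: "u = w" if "?c u = {w}" for u w
    using mem_reach_self[of u F] that by auto
  have "(?c a, ?c v) \<in> reach (?E - {{?c a, ?c b}})" if "(a, v) \<in> reach (edges G - {{a, b}})" for v
    using that
  proof (induction rule: reach_induct)
    case (step x y)
    show ?case
    proof (cases "?c x = ?c y")
      case True
      then show ?thesis using step by simp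
    next
      case False
      have "{?c x, ?c y} \<noteq> {?c a, ?c b}"
      proof
        assume "{?c x, ?c y} = {?c a, ?c b}"
        then have "?c x = {a} \<and> ?c y = {b} \<or> ?c x = {b} \<and> ?c y = {a}"
          unfolding a b by (auto simp only: doubleton_eq_iff)
        then have "{x, y} = {a, b}" using eq by blast
        then show False using step(2) by blast
      qed
      then have "{?c x, ?c y} \<in> ?E - {{?c a, ?c b}}" using edge[of x y] step False by auto
      then show ?thesis using step by (meson reach_edge reach_trans)
    qed
  qed simp
  moreover have "?c a \<noteq> ?c b" using a b ab by simp
  ultimately show False using acycD[OF ac edge[OF ab(1)]] r by blast
qed

lemma infinite_untouched_indices:
  fixes S :: "nat \<Rightarrow> 'a set"
  assumes "finite T" "\<And>m n. m \<noteq> n \<Longrightarrow> S m \<inter> S n = {}"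
  shows "infinite {n. S n \<inter> T = {}}"
proof
  assume fin: "finite {n. S n \<inter> T = {}}"
  have "finite {n. t \<in> S n}" for t
  proof (cases "\<exists>n. t \<in> S n")
    case True
    then obtain n where "t \<in> S n" by blast
    then have "{n. t \<in> S n} \<subseteq> {n}" using assms(2) by blast
    then show ?thesis by (rule finite_subset) simp
  qed simp
  then have "finite (\<Union>t\<in>T. {n. t \<in> S n})" using assms(1) by blast
  moreover have "UNIV = {n. S n \<inter> T = {}} \<union> (\<Union>t\<in>T. {n. t \<in> S n})" by blast
  ultimately show False using fin by (metis finite_UnI infinite_UNIV_nat)
qed

text \<open>Detours may be routed freely through branch sets that the finite changes do not touch.\<close>

lemma conn_reach_avoiding:
  assumes G: "simple_graph G" and D: "\<Union>D \<subseteq> T"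
    and W: "conn (edges G) W" "x \<in> W" "y \<in> W" "W \<inter> T = {}" "a \<notin> W \<or> b \<notin> W"
  shows "(x, y) \<in> reach (edges G - D - {{a, b}})"
proof (rule reach_mono)
  show "(x, y) \<in> reach (induced (edges G) W)" using W by (auto simp: conn_def)
  show "induced (edges G) W \<subseteq> edges G - D - {{a, b}}"
  proof
    fix e assume "e \<in> induced (edges G) W"
    then have e: "e \<in> edges G" "e \<subseteq> W" by (auto simp: induced_def)
    then have "e \<noteq> {}" using G by (auto simp: simple_graph_def)
    then have "\<not> e \<subseteq> T" using e W(4) by blast
    then show "e \<in> edges G - D - {{a, b}}" using D W(5) e by blast
  qed
qed

text \<open>Some triangle is disjoint from \<open>T\<close>; the edge between two of its branch sets has a detour through
  the third.\<close>

lemma omega_K3_minor_free_edge: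
  assumes G: "simple_graph G" and m: "is_minor omega_K3 G"
    and T: "finite T" and D: "\<Union>D \<subseteq> T"
  obtains a b where "{a, b} \<in> edges G - D" "a \<noteq> b" "a \<notin> T" "b \<notin> T"
    "(a, b) \<in> reach (edges G - D - {{a, b}})"
proof -
  obtain S where
    S: "\<And>v. v \<in> verts omega_K3 \<Longrightarrow> conn (edges G) (S v)"
      "\<And>u v. u \<in> verts omega_K3 \<Longrightarrow> v \<in> verts omega_K3 \<Longrightarrow> u \<noteq> v \<Longrightarrow> S u \<inter> S v = {}"
      "\<And>u v. {u, v} \<in> edges omega_K3 \<Longrightarrow> adj (edges G) (S u) (S v)"
    using m unfolding is_minor_iff[OF G] by blast
  define U where "U n = S (n, 0) \<union> S (n, 1) \<union> S (n, 2)" for n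
  have v: "(n, i) \<in> verts omega_K3" if "i < 3" for n i using that by (simp add: omega_K3_def)
  have e: "{(n, i), (n, j)} \<in> edges omega_K3" if "i < 3" "j < 3" "i \<noteq> j" for n i j
    using that unfolding omega_K3_def by auto
  have "U m \<inter> U n = {}" if "m \<noteq> n" for m n
    unfolding U_def Int_Un_distrib Int_Un_distrib2 using that
    by (simp add: S(2)[OF v v])
  then have "infinite {n. U n \<inter> T = {}}" using T by (rule infinite_untouched_indices[rotated])
  then obtain n where "U n \<inter> T = {}" using not_finite_existsD by blast
  then have u: "S (n, 0) \<inter> T = {}" "S (n, 1) \<inter> T = {}" "S (n, 2) \<inter> T = {}"
    by (auto simp: U_def)
  have dis: "S (n, 0) \<inter> S (n, 1) = {}" "S (n, 0) \<inter> S (n, 2) = {}" "S (n, 1) \<inter> S (n, 2) = {}"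
    by (simp_all add: S(2)[OF v v])
  obtain a b where ab: "a \<in> S (n, 0)" "b \<in> S (n, 1)" "{a, b} \<in> edges G"
    using S(3)[OF e[of 0 1 n]] by (auto simp: adj_def)
  obtain c d where cd: "c \<in> S (n, 0)" "d \<in> S (n, 2)" "{c, d} \<in> edges G"
    using S(3)[OF e[of 0 2 n]] by (auto simp: adj_def)
  obtain f g where fg: "f \<in> S (n, 1)" "g \<in> S (n, 2)" "{f, g} \<in> edges G"
    using S(3)[OF e[of 1 2 n]] by (auto simp: adj_def)
  let ?E = "edges G - D - {{a, b}}"
  note ind = conn_reach_avoiding[OF G D]
  have edge: "(x, y) \<in> reach ?E" if "{x, y} \<in> edges G" "y \<notin> T" "y \<notin> {a, b}" for x y
    using that D by (intro reach_edge) blast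
  have "(a, c) \<in> reach ?E" using ab cd u dis by (intro ind[OF S(1)[OF v[of 0]]]) auto
  moreover have "(c, d) \<in> reach ?E" using ab cd u dis by (intro edge) auto
  moreover have "(d, g) \<in> reach ?E" using ab cd fg u dis by (intro ind[OF S(1)[OF v[of 2]]]) auto
  moreover have "(f, g) \<in> reach ?E" using ab fg u dis by (intro edge) auto
  moreover have "(f, b) \<in> reach ?E" using ab fg u dis by (intro ind[OF S(1)[OF v[of 1]]]) auto
  ultimately have "(a, b) \<in> reach ?E" by (meson reach_trans reach_sym)
  moreover have "a \<noteq> b" "a \<notin> T" "b \<notin> T" using ab u dis by auto
  moreover have "{a, b} \<in> edges G - D" using ab u D by auto
  ultimately show thesis using that by blast
qed

text \<open>The walk can be started again after its last deleted edge. So removing finitely many edges splits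
  a connected set into finitely many pieces, each containing one of finitely many representatives.\<close>

lemma reach_after_deletion:
  assumes "(s, v) \<in> reach E"
  shows "\<exists>x\<in>insert s (\<Union>D). (x, v) \<in> reach (E - D)"
  using assms
proof (induction rule: reach_induct)
  case (step u v)
  show ?case
  proof (cases "{u, v} \<in> D")
    case True
    then have "v \<in> insert s (\<Union>D)" by blast
    then show ?thesis by (intro bexI[of _ v]) simp_all
  next
    case False
    then have "{u, v} \<in> E - D" using step by simp
    then show ?thesis using step by (meson reach_edge reach_trans)
  qed
qed auto

text \<open>The centre may be touched by the changes, but two untouched triangles \<open>n\<close> and \<open>m\<close> attach to the
  same two pieces of it. The edge inside triangle \<open>n\<close> then has a detour that runs through these two
  pieces and through triangle \<open>m\<close>.\<close>

lemma vee_K3_minor_free_edge: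
  assumes G: "simple_graph G" and m: "is_minor vee_K3 G"
    and T: "finite T" and D: "\<Union>D \<subseteq> T"
  obtains a b where "{a, b} \<in> edges G - D" "a \<noteq> b" "a \<notin> T" "b \<notin> T"
    "(a, b) \<in> reach (edges G - D - {{a, b}})"
proof -
  obtain S where
    S: "\<And>v. v \<in> verts vee_K3 \<Longrightarrow> S v \<subseteq> verts G \<and> S v \<noteq> {} \<and> conn (edges G) (S v)"
      "\<And>u v. u \<in> verts vee_K3 \<Longrightarrow> v \<in> verts vee_K3 \<Longrightarrow> u \<noteq> v \<Longrightarrow> S u \<inter> S v = {}"
      "\<And>u v. {u, v} \<in> edges vee_K3 \<Longrightarrow> adj (edges G) (S u) (S v)"
    using m unfolding is_minor_iff[OF G] by (elim exE conjE) metis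
  define W where "W = S (0, 0)"
  define A B where "A n = S (n, 1)" and "B n = S (n, 2)" for n
  have v0: "(0, 0) \<in> verts vee_K3" and v1: "(n, 1) \<in> verts vee_K3"
    and v2: "(n, 2) \<in> verts vee_K3" for n
    unfolding verts_vee_K3 by blast+
  have disW: "W \<inter> A n = {}" "W \<inter> B n = {}" for n
    unfolding W_def A_def B_def using S(2)[OF v0 v1[of n]] S(2)[OF v0 v2[of n]] by simp_all
  have disAB: "A m \<inter> B n = {}" for m n
    unfolding A_def B_def using S(2)[OF v1[of m] v2[of n]] by simp
  have dis: "A m \<inter> A n = {}" "B m \<inter> B n = {}" if "m \<noteq> n" for m n
    unfolding A_def B_def using that S(2)[OF v1[of m] v1[of n]] S(2)[OF v2[of m] v2[of n]]
    by simp_all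
  have con: "conn (edges G) W" "conn (edges G) (A n)" "conn (edges G) (B n)" for n
    unfolding W_def A_def B_def using S(1)[OF v0] S(1)[OF v1[of n]] S(1)[OF v2[of n]] by simp_all
  obtain s where s: "s \<in> W" using S(1)[OF v0] by (auto simp: W_def)
  have adj: "adj (edges G) W (A n)" "adj (edges G) W (B n)" "adj (edges G) (A n) (B n)" for n
    unfolding W_def A_def B_def by (rule S(3), unfold edges_vee_K3, blast)+
  obtain u p where up: "\<And>n. u n \<in> W" "\<And>n. p n \<in> A n" "\<And>n. {u n, p n} \<in> edges G"
    using adj(1) unfolding adj_def by metis
  obtain v q where vq: "\<And>n. v n \<in> W" "\<And>n. q n \<in> B n" "\<And>n. {v n, q n} \<in> edges G"
    using adj(2) unfolding adj_def by metis
  obtain a b where ab: "\<And>n. a n \<in> A n" "\<And>n. b n \<in> B n" "\<And>n. {a n, b n} \<in> edges G"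
    using adj(3) unfolding adj_def by metis
  define N where "N = {n. (A n \<union> B n) \<inter> T = {}}"
  have "(A m \<union> B m) \<inter> (A n \<union> B n) = {}" if "m \<noteq> n" for m n
    using dis[OF that] disAB[of m n] disAB[of n m] by blast
  then have "infinite N" using T unfolding N_def by (rule infinite_untouched_indices[rotated])
  have "\<exists>x\<in>insert s (\<Union>D). (x, w) \<in> reach (induced (edges G) W - D)" if "w \<in> W" for w
    using reach_after_deletion con(1) s that unfolding conn_def by metis
  then obtain r where r: "\<And>w. w \<in> W \<Longrightarrow> r w \<in> insert s (\<Union>D)"
      "\<And>w. w \<in> W \<Longrightarrow> (r w, w) \<in> reach (induced (edges G) W - D)"
    by metis
  \<comment> \<open>\<open>r w\<close> represents the piece of the centre containing \<open>w\<close>; pigeonhole on the pair of pieces to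
    which the triangle \<open>n\<close> is attached\<close>
  have "(\<lambda>n. (r (u n), r (v n))) ` N \<subseteq> insert s T \<times> insert s T"
    using r(1) up(1) vq(1) D by blast
  then have "finite ((\<lambda>n. (r (u n), r (v n))) ` N)" using T by (meson finite.insertI finite_SigmaI finite_subset)
  with \<open>infinite N\<close> obtain n where n: "n \<in> N"
    and inf: "infinite {k \<in> N. (r (u k), r (v k)) = (r (u n), r (v n))}"
    using pigeonhole_infinite[of N "\<lambda>n. (r (u n), r (v n))"] by blast
  then obtain m where m: "m \<in> N" "m \<noteq> n" "r (u m) = r (u n)" "r (v m) = r (v n)"
    using infinite_imp_nonempty[OF infinite_remove[OF inf, of n]] by blast
  let ?E = "edges G - D - {{a n, b n}}"
  have ab': "a n \<notin> W" "b n \<notin> W" "a n \<noteq> b n" "\<And>k. a n \<notin> B k" "\<And>k. b n \<notin> A k"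
    "a n \<notin> A m"
    using ab(1)[of n] ab(2)[of n] disW[of n] disAB[of n] disAB[of _ n] dis(1)[OF m(2)]
    by (auto simp: disjoint_iff)
  note ind = conn_reach_avoiding[OF G D]
  have N: "A k \<inter> T = {}" "B k \<inter> T = {}" if "k \<in> N" for k
    using that by (auto simp: N_def)
  have ua: "(u k, a k) \<in> reach ?E" if k: "k \<in> N" for k
  proof (rule reach_trans)
    have "p k \<notin> T" using N(1)[OF k] up(2) by blast
    then have "{u k, p k} \<notin> D" using D by blast
    moreover have "{u k, p k} \<noteq> {a n, b n}" using up(1)[of k] ab'(1,2) by (auto simp: doubleton_eq_iff)
    ultimately show "(u k, p k) \<in> reach ?E" using up(3) by (intro reach_edge) blast
    show "(p k, a k) \<in> reach ?E"
      by (rule ind[OF con(2) up(2) ab(1) N(1)[OF k]]) (use ab'(5) in blast)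
  qed
  have vb: "(v k, b k) \<in> reach ?E" if k: "k \<in> N" for k
  proof (rule reach_trans)
    have "q k \<notin> T" using N(2)[OF k] vq(2) by blast
    then have "{v k, q k} \<notin> D" using D by blast
    moreover have "{v k, q k} \<noteq> {a n, b n}" using vq(1)[of k] ab'(1,2) by (auto simp: doubleton_eq_iff)
    ultimately show "(v k, q k) \<in> reach ?E" using vq(3) by (intro reach_edge) blast
    show "(q k, b k) \<in> reach ?E"
      by (rule ind[OF con(3) vq(2) ab(2) N(2)[OF k]]) (use ab'(4) in blast)
  qed
  have "induced (edges G) W - D \<subseteq> ?E" using ab' by (auto simp: induced_def)
  then have rw: "(r w, w) \<in> reach ?E" if "w \<in> W" for w using r(2)[OF that] by (rule reach_mono[rotated])
  have "(u n, u m) \<in> reach ?E" "(v m, v n) \<in> reach ?E"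
    using rw[OF up(1)[of n]] rw[OF up(1)[of m]] rw[OF vq(1)[of n]] rw[OF vq(1)[of m]]
    unfolding m(3,4) by (meson reach_sym reach_trans)+
  moreover have "(a m, b m) \<in> reach ?E"
  proof (rule reach_edge)
    have "a m \<notin> T" using N(1)[OF m(1)] ab(1) by blast
    then have "{a m, b m} \<notin> D" using D by blast
    moreover have "{a m, b m} \<noteq> {a n, b n}"
      using ab'(5)[of m] ab'(6) ab(1)[of m] by (auto simp: doubleton_eq_iff)
    ultimately show "{a m, b m} \<in> ?E" using ab(3)[of m] by blast
  qed
  ultimately have "(a n, b n) \<in> reach ?E"
    using ua[OF n] ua[OF m(1)] vb[OF n] vb[OF m(1)] by (meson reach_sym reach_trans)
  moreover have nT: "a n \<notin> T" "b n \<notin> T" using N[OF n] ab(1,2)[of n] by blast+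
  moreover from nT have "{a n, b n} \<in> edges G - D" using ab(3)[of n] D by blast
  ultimately show thesis using that ab'(3) by blast
qed

text \<open>Deleting before contracting is the convenient order here: the changes then are two sets of edges
  of \<open>G\<close> itself, and \<open>T\<close> can be taken as the set of their ends.\<close>

lemma fin_delete_contract_subset_Forb:
  "fin_delete_contract forests \<subseteq> (Forb {omega_K3, vee_K3} :: 'a graph set)"
proof
  fix G :: "'a graph"
  assume "G \<in> fin_delete_contract forests"
  then obtain D F where G: "countable_graph G" and D: "finite D" "D \<subseteq> edges G"
    and F: "finite F" "F \<subseteq> edges G - D"
    and C: "contract_edges (delete_edges G D) F \<in> forests"
    unfolding fin_delete_contract_commute
    by (auto simp: fin_delete_def fin_contract_def delete_edges_def)
  have s: "simple_graph G" using G by (simp add: countable_graph_def)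
  have s': "simple_graph (delete_edges G D)"
    using countable_graph_delete[OF G] by (simp add: countable_graph_def)
  have fin: "finite (\<Union>(D \<union> F))"
  proof (rule finite_Union)
    show "finite e" if "e \<in> D \<union> F" for e
    proof -
      have "e \<in> edges G" using that D(2) F(2) by blast
      then have "card e = 2" using s by (simp add: simple_graph_def)
      then show ?thesis by (intro card_ge_0_finite) simp
    qed
  qed (use D F in simp)
  have "\<not> is_minor H G" if "H \<in> {omega_K3, vee_K3}" for H
  proof
    assume "is_minor H G"
    then have "is_minor omega_K3 G \<or> is_minor vee_K3 G" using that by auto
    moreover have "\<Union>D \<subseteq> \<Union>(D \<union> F)" by blast
    ultimately obtain a b where "{a, b} \<in> edges G - D" "a \<noteq> b"
      "a \<notin> \<Union>(D \<union> F)" "b \<notin> \<Union>(D \<union> F)" "(a, b) \<in> reach (edges G - D - {{a, b}})"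
      using omega_K3_minor_free_edge[OF s _ fin] vee_K3_minor_free_edge[OF s _ fin]
      by (elim disjE) metis+
    then have "\<not> acyc (edges (contract_edges (delete_edges G D) F))"
      by (intro contracted_edge_not_bridge[OF s', of a b]) (auto simp: delete_edges_def)
    then show False using C by (simp add: forests_iff_acyc)
  qed
  then show "G \<in> Forb {omega_K3, vee_K3}" using G by (simp add: Forb_def)
qed

section \<open>Finite hitting sets\<close>

text \<open>If no finite set meets all the objects, the next object can always be chosen away from the
  finitely many chosen so far. Applied to cycles and to ears, this is the infinite form of the
  Erdos-Posa property, and it needs nothing beyond this greedy choice.\<close>

lemma disjoint_family_or_hitting_set:
  fixes g :: "'b \<Rightarrow> 'a set"
  assumes "\<And>Y. finite Y \<Longrightarrow> \<exists>x. P x \<and> finite (g x) \<and> g x \<inter> Y = {}"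
  obtains f :: "nat \<Rightarrow> 'b" where "\<forall>n. P (f n)" "\<forall>m n. m \<noteq> n \<longrightarrow> g (f m) \<inter> g (f n) = {}"
proof -
  have "\<exists>h. \<forall>n. (P (fst (h n)) \<and> finite (snd (h n)) \<and> g (fst (h n)) \<subseteq> snd (h n)) \<and>
      (g (fst (h (Suc n))) \<inter> snd (h n) = {} \<and> snd (h n) \<subseteq> snd (h (Suc n)))"
  proof (rule dependent_nat_choice)
    obtain x where "P x" "finite (g x)" using assms[of "{}"] by auto
    then show "\<exists>x. P (fst x) \<and> finite (snd x) \<and> g (fst x) \<subseteq> snd x"
      by (intro exI[of _ "(x, g x)"]) auto
  next
    fix s :: "'b \<times> 'a set" and n :: nat
    assume s: "P (fst s) \<and> finite (snd s) \<and> g (fst s) \<subseteq> snd s"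
    then obtain x where "P x" "finite (g x)" "g x \<inter> snd s = {}" using assms by blast
    with s show "\<exists>y. (P (fst y) \<and> finite (snd y) \<and> g (fst y) \<subseteq> snd y) \<and>
        (g (fst y) \<inter> snd s = {} \<and> snd s \<subseteq> snd y)"
      by (intro exI[of _ "(x, g x \<union> snd s)"]) auto
  qed
  then obtain h where h: "\<And>n. P (fst (h n))" "\<And>n. g (fst (h n)) \<subseteq> snd (h n)"
      "\<And>n. g (fst (h (Suc n))) \<inter> snd (h n) = {}" "\<And>n. snd (h n) \<subseteq> snd (h (Suc n))"
    by blast
  have mono: "snd (h m) \<subseteq> snd (h n)" if "m \<le> n" for m n
    using that h(4) by (rule lift_Suc_mono_le[of "\<lambda>n. snd (h n)", rotated])
  have less: "g (fst (h m)) \<inter> g (fst (h n)) = {}" if "m < n" for m n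
  proof -
    obtain k where k: "n = Suc k" "m \<le> k" using \<open>m < n\<close> by (cases n) auto
    then show ?thesis using h(2)[of m] h(3)[of k] mono[of m k] by blast
  qed
  show thesis
  proof (rule that[of "\<lambda>n. fst (h n)"])
    show "\<forall>n. P (fst (h n))" using h(1) by blast
    show "\<forall>m n. m \<noteq> n \<longrightarrow> g (fst (h m)) \<inter> g (fst (h n)) = {}"
      using less by (metis Int_commute linorder_neqE_nat)
  qed
qed

lemma finite_cycle_hitting_set:
  assumes G: "simple_graph G" and nm: "\<not> is_minor omega_K3 G"
  obtains X where "finite X" "acyc (induced (edges G) (- X))"
proof -
  let ?E = "edges G"
  define P where "P = (\<lambda>(a, x, V). finite V \<and> conn ?E V \<and> a \<notin> V \<and> x \<notin> V \<and> a \<noteq> x \<and> V \<noteq> {} \<and>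
    {a, x} \<in> ?E \<and> adj ?E {x} V \<and> adj ?E {a} V \<and> insert a (insert x V) \<subseteq> verts G)"
  define g where "g = (\<lambda>(a :: 'a, x, V). insert a (insert x V))"
  have "\<exists>X. finite X \<and> acyc (induced ?E (- X))"
  proof (rule ccontr)
    assume no: "\<nexists>X. finite X \<and> acyc (induced ?E (- X))"
    have "\<exists>t. P t \<and> finite (g t) \<and> g t \<inter> Y = {}" if "finite Y" for Y
    proof -
      have "\<not> acyc (induced ?E (- Y))" using no that by blast
      then obtain a x V where t: "finite V" "conn (induced ?E (- Y)) V" "a \<notin> V" "x \<notin> V" "a \<noteq> x"
        "V \<noteq> {}" "{a, x} \<in> induced ?E (- Y)" "adj (induced ?E (- Y)) {x} V"
        "adj (induced ?E (- Y)) {a} V" "insert a (insert x V) \<subseteq> \<Union>(induced ?E (- Y))"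
        by (rule triangle_if_not_acyc)
      have sub: "induced ?E (- Y) \<subseteq> ?E" by (auto simp: induced_def)
      have "adj ?E {x} V" "adj ?E {a} V" using t(8,9) sub unfolding adj_def by blast+
      moreover have "conn ?E V" using t(2) sub by (rule conn_mono)
      moreover have "insert a (insert x V) \<subseteq> verts G \<and> insert a (insert x V) \<inter> Y = {}"
      proof -
        have "\<Union>(induced ?E (- Y)) \<subseteq> \<Union>?E" "\<Union>(induced ?E (- Y)) \<inter> Y = {}"
          by (auto simp: induced_def)
        moreover note t(10) simple_edges_subset[OF G]
        ultimately show ?thesis by (meson disjoint_iff subset_eq)
      qed
      ultimately have "P (a, x, V) \<and> finite (g (a, x, V)) \<and> g (a, x, V) \<inter> Y = {}"
        using t(1,3-6) subsetD[OF sub t(7)] unfolding P_def g_def prod.case by blast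
      then show ?thesis by blast
    qed
    then obtain f where f: "\<forall>n::nat. P (f n)" "\<forall>m n. m \<noteq> n \<longrightarrow> g (f m) \<inter> g (f n) = {}"
      by (rule disjoint_family_or_hitting_set)
    define a x V where "a n = fst (f n)" and "x n = fst (snd (f n))" and "V n = snd (snd (f n))" for n
    have fe: "f n = (a n, x n, V n)" for n by (simp add: a_def x_def V_def)
    have p: "conn ?E (V n)" "a n \<notin> V n" "x n \<notin> V n" "a n \<noteq> x n" "V n \<noteq> {}" "{a n, x n} \<in> ?E"
        "adj ?E {x n} (V n)" "adj ?E {a n} (V n)" "insert (a n) (insert (x n) (V n)) \<subseteq> verts G" for n
      using spec[OF f(1), of n] by (simp_all add: fe P_def)
    have "is_minor omega_K3 G"
    proof (rule omega_K3_minorI[OF G, of "\<lambda>n. {a n}" "\<lambda>n. {x n}" V])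
      show "({a m} \<union> {x m} \<union> V m) \<inter> ({a n} \<union> {x n} \<union> V n) = {}" if "m \<noteq> n" for m n
      proof -
        have "insert (a m) (insert (x m) (V m)) \<inter> insert (a n) (insert (x n) (V n)) = {}"
          using f(2) that unfolding fe g_def by simp
        then show ?thesis by simp
      qed
      show "{a n} \<inter> {x n} = {}" "{x n} \<inter> V n = {}" "{a n} \<inter> V n = {}" for n
        using p(2-4)[of n] by simp_all
      show "{a n} \<union> {x n} \<union> V n \<subseteq> verts G" for n using p(9)[of n] by simp
      show "adj ?E {a n} {x n}" for n using p(6)[of n] by (simp add: adj_def)
    qed (simp_all only: p conn_singleton insert_not_empty not_False_eq_True)
    then show False using nm by blast
  qed
  then show thesis using that by blast
qed

text \<open>Connectedness of \<open>Z\<close> inside each component. Plain connectedness would be too much to ask as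
  \<open>G\<close> itself may be disconnected.\<close>

definition class_connected :: "'a set set \<Rightarrow> 'a set \<Rightarrow> bool" where
  "class_connected E Z \<longleftrightarrow> (\<forall>u\<in>Z. \<forall>v\<in>Z. (u, v) \<in> reach E \<longrightarrow> (u, v) \<in> reach (induced E Z))"

text \<open>Adding one path for each pair of connected vertices of \<open>X\<close> suffices, as every vertex of such a
  path is tied to its ends. The last conclusion keeps this information: the hull has no parts away from
  \<open>X\<close>.\<close>

lemma class_connected_hull:
  assumes "finite X"
  obtains Z where "finite Z" "X \<subseteq> Z" "class_connected E Z" "Z \<subseteq> X \<union> \<Union>E"
    "\<forall>w\<in>Z. \<exists>x\<in>X. (w, x) \<in> reach (induced E Z)"
proof -
  have "\<exists>V. finite V \<and> conn E V \<and> u \<in> V \<and> v \<in> V \<and> V \<subseteq> insert u (\<Union>E)" if "(u, v) \<in> reach E" for u v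
    using reach_finite_conn[OF that] by metis
  then obtain V where V: "\<And>u v. (u, v) \<in> reach E \<Longrightarrow>
      finite (V u v) \<and> conn E (V u v) \<and> u \<in> V u v \<and> v \<in> V u v \<and> V u v \<subseteq> insert u (\<Union>E)"
    by metis
  define Z where "Z = X \<union> (\<Union>(u, v)\<in>{(u, v). u \<in> X \<and> v \<in> X \<and> (u, v) \<in> reach E}. V u v)"
  have "{(u, v). u \<in> X \<and> v \<in> X \<and> (u, v) \<in> reach E} \<subseteq> X \<times> X" by blast
  then have "finite {(u, v). u \<in> X \<and> v \<in> X \<and> (u, v) \<in> reach E}"
    using assms by (meson finite_SigmaI finite_subset)
  then have fin: "finite Z" unfolding Z_def using assms V by auto
  have VZ: "V u v \<subseteq> Z" if "u \<in> X" "v \<in> X" "(u, v) \<in> reach E" for u v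
    using that unfolding Z_def by blast
  have inV: "(w, w') \<in> reach (induced E Z)"
    if "u \<in> X" "v \<in> X" "(u, v) \<in> reach E" "w \<in> V u v" "w' \<in> V u v" for u v w w'
    using V[OF that(3)] VZ[OF that(1-3)] that(4,5) unfolding conn_def
    by (meson reach_induced_mono subset_refl)
  have near: "\<exists>x\<in>X. (w, x) \<in> reach (induced E Z)" if w: "w \<in> Z" for w
  proof (cases "w \<in> X")
    case False
    then obtain u v where uv: "u \<in> X" "v \<in> X" "(u, v) \<in> reach E" "w \<in> V u v"
      using w unfolding Z_def by blast
    then show ?thesis using inV[OF uv, of u] V[OF uv(3)] by blast
  qed (use reach_refl[of w "induced E Z"] in blast)
  have "class_connected E Z"
    unfolding class_connected_def
  proof (intro ballI impI)
    fix w w' assume w: "w \<in> Z" "w' \<in> Z" "(w, w') \<in> reach E"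
    obtain x x' where x: "x \<in> X" "(w, x) \<in> reach (induced E Z)" "x' \<in> X" "(w', x') \<in> reach (induced E Z)"
      using near w by meson
    have xx: "(x, x') \<in> reach E" using w(3) x(2,4) reach_induced_D reach_sym reach_trans by metis
    then have "(x, x') \<in> reach (induced E Z)" using inV[OF x(1,3) xx] V[OF xx] by blast
    then show "(w, w') \<in> reach (induced E Z)" using x(2,4) reach_sym reach_trans by metis
  qed
  moreover have "Z \<subseteq> X \<union> \<Union>E" unfolding Z_def using V by blast
  ultimately show thesis using that[of Z] fin near unfolding Z_def by blast
qed

text \<open>Otherwise there are infinitely many disjoint ears, and infinitely many of them have their first
  ends \<open>p\<close> adjacent to the same \<open>z \<in> Z\<close>. Their other ends are adjacent to the class of \<open>z\<close> within
  \<open>Z\<close>, because they lie in the same component of \<open>G\<close> and \<open>Z\<close> is connected there. This class is the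
  centre of a \<open>\<Or>K\<^sub>3\<close> minor.\<close>

lemma finite_ear_hitting_set:
  assumes G: "simple_graph G" and nm: "\<not> is_minor vee_K3 G"
    and Z: "finite Z" "class_connected (edges G) Z"
  obtains Y where "finite Y"
    "\<And>p q. p \<noteq> q \<Longrightarrow> (p, q) \<in> reach (induced (edges G) (- (Z \<union> Y))) \<Longrightarrow>
       adj (edges G) {p} Z \<Longrightarrow> adj (edges G) {q} Z \<Longrightarrow> False"
proof -
  let ?E = "edges G"
  define P where "P = (\<lambda>(p, V). finite V \<and> conn ?E V \<and> p \<notin> V \<and> insert p V \<inter> Z = {} \<and>
    insert p V \<subseteq> verts G \<and> adj ?E {p} V \<and> adj ?E {p} Z \<and> adj ?E V Z)"
  define g where "g = (\<lambda>(p :: 'a, V). insert p V)"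
  have "\<exists>Y. finite Y \<and> (\<forall>p q. p \<noteq> q \<longrightarrow> (p, q) \<in> reach (induced ?E (- (Z \<union> Y))) \<longrightarrow>
       adj ?E {p} Z \<longrightarrow> \<not> adj ?E {q} Z)"
  proof (rule ccontr)
    assume no: "\<not> ?thesis"
    have "\<exists>t. P t \<and> finite (g t) \<and> g t \<inter> Y = {}" if fin: "finite Y" for Y
    proof -
      let ?F = "induced ?E (- (Z \<union> Y))"
      obtain p q where pq: "p \<noteq> q" "(p, q) \<in> reach ?F" "adj ?E {p} Z" "adj ?E {q} Z"
        using no fin by blast
      obtain x V where V: "{p, x} \<in> ?F" "x \<in> V" "q \<in> V" "p \<notin> V" "finite V" "conn ?F V" "V \<subseteq> \<Union>?F"
        using path_split_first[OF pq(2,1)] by blast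
      have sub: "?F \<subseteq> ?E" by (auto simp: induced_def)
      have "insert p V \<subseteq> \<Union>?F" using V(1,7) by blast
      moreover have "\<Union>?F \<subseteq> \<Union>?E" "\<Union>?F \<inter> (Z \<union> Y) = {}" by (auto simp: induced_def)
      ultimately have "insert p V \<subseteq> verts G" "insert p V \<inter> (Z \<union> Y) = {}"
        using simple_edges_subset[OF G] by blast+
      moreover have "conn ?E V" using V(6) sub by (rule conn_mono)
      moreover have "adj ?E {p} V" "adj ?E V Z"
        using V(1-3) sub pq(4) unfolding adj_def by blast+
      ultimately have "P (p, V) \<and> finite (g (p, V)) \<and> g (p, V) \<inter> Y = {}"
        using V(4,5) pq(3) unfolding P_def g_def prod.case by blast
      then show ?thesis by blast
    qed
    then obtain f where f: "\<forall>n::nat. P (f n)" "\<forall>m n. m \<noteq> n \<longrightarrow> g (f m) \<inter> g (f n) = {}"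
      by (rule disjoint_family_or_hitting_set)
    define p V where "p n = fst (f n)" and "V n = snd (f n)" for n
    have fe: "f n = (p n, V n)" for n by (simp add: p_def V_def)
    have p: "conn ?E (V n)" "p n \<notin> V n" "insert (p n) (V n) \<inter> Z = {}" "insert (p n) (V n) \<subseteq> verts G"
        "adj ?E {p n} (V n)" "adj ?E {p n} Z" "adj ?E (V n) Z" for n
      using spec[OF f(1), of n] by (simp_all add: fe P_def)
    have dis: "insert (p m) (V m) \<inter> insert (p n) (V n) = {}" if "m \<noteq> n" for m n
      using f(2) that unfolding fe g_def by simp
    have "\<forall>n. \<exists>z\<in>Z. {p n, z} \<in> ?E" using p(6) by (auto simp: adj_def)
    then obtain z where z: "\<And>n. z n \<in> Z" "\<And>n. {p n, z n} \<in> ?E" by metis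
    have "finite (range z)" using z(1) Z(1) by (meson finite_subset image_subsetI)
    then obtain k where k: "infinite {n. z n = z k}"
      using pigeonhole_infinite[OF infinite_UNIV_nat] by fastforce
    then obtain r :: "nat \<Rightarrow> nat" where r: "strict_mono r" "\<And>n. z (r n) = z k"
      using infinite_enumerate by blast
    have inj: "r m \<noteq> r n" if "m \<noteq> n" for m n
      using that r(1) by (simp add: strict_mono_eq)
    \<comment> \<open>the centre: the part of \<open>Z\<close> around the common neighbour\<close>
    define W where "W = reach (induced ?E Z) `` {z k}"
    have zW: "z k \<in> W" by (simp add: W_def)
    have WZ: "W \<subseteq> Z"
    proof
      fix w assume "w \<in> W"
      then show "w \<in> Z" using reach_induced[of "z k" w ?E Z] z(1)[of k] by (auto simp: W_def)
    qed
    have Zv: "z k \<in> verts G" using z(2)[of k] simple_edges_subset[OF G] by blast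
    have Wv: "W \<subseteq> verts G"
    proof
      fix w assume "w \<in> W"
      then have "(z k, w) \<in> reach ?E"
        unfolding W_def using reach_induced_D[of "z k" w ?E Z] by simp
      then show "w \<in> verts G" using reach_in_Union[of "z k" w ?E] Zv simple_edges_subset[OF G] by blast
    qed
    have adjV: "adj ?E (V (r n)) W" for n
    proof -
      obtain v z' where v: "v \<in> V (r n)" "z' \<in> Z" "{v, z'} \<in> ?E"
        using p(7)[of "r n"] unfolding adj_def by blast
      obtain u where u: "u \<in> V (r n)" "{p (r n), u} \<in> ?E"
        using p(5)[of "r n"] unfolding adj_def by blast
      have "{p (r n), z k} \<in> ?E" using z(2)[of "r n"] r(2)[of n] by simp
      then have "(z k, p (r n)) \<in> reach ?E" by (rule reach_sym[OF reach_edge])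
      also have "(p (r n), u) \<in> reach ?E" using u(2) by (rule reach_edge)
      also have "(u, v) \<in> reach ?E"
      proof (rule reach_induced_D)
        show "(u, v) \<in> reach (induced ?E (V (r n)))"
          using p(1)[of "r n"] u(1) v(1) unfolding conn_def by simp
      qed
      also have "(v, z') \<in> reach ?E" using v(3) by (rule reach_edge)
      finally have "(z k, z') \<in> reach ?E" .
      then have "z' \<in> W"
        using Z(2) z(1)[of k] v(2) unfolding class_connected_def W_def by simp
      then show ?thesis using v(1,3) unfolding adj_def by blast
    qed
    have "is_minor vee_K3 G"
    proof (rule vee_K3_minorI[OF G, of W "\<lambda>n. {p (r n)}" "\<lambda>n. V (r n)"])
      show "conn ?E W" unfolding W_def by (rule conn_reach_class) (auto simp: induced_def)
      show "({p (r m)} \<union> V (r m)) \<inter> ({p (r n)} \<union> V (r n)) = {}" if "m \<noteq> n" for m n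
        using dis[OF inj[OF that]] by simp
      show "W \<inter> ({p (r n)} \<union> V (r n)) = {}" for n using p(3)[of "r n"] WZ by blast
      show "adj ?E {p (r n)} W" for n using z(2)[of "r n"] r(2)[of n] zW by (auto simp: adj_def)
      show "V (r n) \<noteq> {}" for n using p(5)[of "r n"] by (auto simp: adj_def)
      show "W \<noteq> {}" using zW by blast
      show "{p (r n)} \<union> V (r n) \<subseteq> verts G" for n using p(4)[of "r n"] by simp
      show "{p (r n)} \<inter> V (r n) = {}" for n using p(2)[of "r n"] by simp
    qed (simp_all only: Wv adjV p(1,5) conn_singleton insert_not_empty not_False_eq_True)
    then show False using nm by blast
  qed
  then show thesis using that by blast
qed

section \<open>A finite set whose contraction leaves a forest\<close>

lemma finite_if_at_most_one: "(\<And>p q. p \<in> A \<Longrightarrow> q \<in> A \<Longrightarrow> p = q) \<Longrightarrow> finite A"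
  by (metis finite.emptyI finite.insertI finite_subset subsetI singletonI equals0I insertCI)

lemma adj_singleton: "adj E {p} Z \<longleftrightarrow> (\<exists>z\<in>Z. {p, z} \<in> E)"
  by (simp add: adj_def)

text \<open>Within the component of \<open>y\<close> in \<open>G - Z\<close>, each \<open>z \<in> Z\<close> has at most one neighbour: two of them are
  the ends of an ear of \<open>X\<close> if \<open>z \<in> X\<close>, and otherwise they close a cycle through \<open>z\<close> in the forest
  \<open>G - X\<close>.\<close>

lemma finite_attachments:
  assumes X: "X \<subseteq> Z" "acyc (induced E (- X))" and Z: "finite Z"
    and ear: "\<And>p q. p \<noteq> q \<Longrightarrow> (p, q) \<in> reach (induced E (- Z)) \<Longrightarrow>
      adj E {p} X \<Longrightarrow> adj E {q} X \<Longrightarrow> False"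
  shows "finite {p. p \<notin> Z \<and> (y, p) \<in> reach (induced E (- Z)) \<and> adj E {p} Z}"
proof -
  define A where "A z = {p. p \<notin> Z \<and> (y, p) \<in> reach (induced E (- Z)) \<and> {p, z} \<in> E}" for z
  have "finite (A z)" if z: "z \<in> Z" for z
  proof (rule finite_if_at_most_one, rule ccontr)
    fix p q assume p: "p \<in> A z" and q: "q \<in> A z" and ne: "p \<noteq> q"
    have pq: "(p, q) \<in> reach (induced E (- Z))"
      using p q unfolding A_def by (blast intro: reach_sym reach_trans)
    show False
    proof (cases "z \<in> X")
      case True
      then show False using ear[OF ne pq] p q by (auto simp: A_def adj_def)
    next
      case False
      let ?E = "induced E (- X)"
      have e: "{p, z} \<in> ?E" "{q, z} \<in> ?E" using p q False X(1) by (auto simp: A_def induced_def)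
      have pz: "p \<noteq> z" "q \<noteq> z" using p q z by (auto simp: A_def)
      have "induced E (- Z) \<subseteq> ?E - {{p, z}}" using X(1) z by (auto simp: induced_def)
      then have "(p, q) \<in> reach (?E - {{p, z}})" using pq by (rule reach_mono[rotated])
      moreover have "(q, z) \<in> reach (?E - {{p, z}})"
        using e ne pz by (intro reach_edge) (auto simp: doubleton_eq_iff)
      ultimately show False using acycD[OF X(2) e(1) pz(1)] reach_trans by metis
    qed
  qed
  then have "finite (\<Union>z\<in>Z. A z)" using Z by blast
  moreover have "{p. p \<notin> Z \<and> (y, p) \<in> reach (induced E (- Z)) \<and> adj E {p} Z} \<subseteq> (\<Union>z\<in>Z. A z)"
    by (auto simp: A_def adj_singleton)
  ultimately show ?thesis by (rule finite_subset[rotated])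
qed

text \<open>The two rounds: \<open>X\<close> meets all cycles, \<open>Z\<close> moreover meets all ears of \<open>X\<close>, and \<open>Z \<union> W\<close> has no
  ears.\<close>

lemma finite_earless_set:
  assumes G: "simple_graph G" and nm: "\<not> is_minor omega_K3 G" "\<not> is_minor vee_K3 G"
  obtains Z where "finite Z" "class_connected (edges G) Z" "acyc (induced (edges G) (- Z))"
    "\<And>p q. p \<noteq> q \<Longrightarrow> (p, q) \<in> reach (induced (edges G) (- Z)) \<Longrightarrow>
       adj (edges G) {p} Z \<Longrightarrow> adj (edges G) {q} Z \<Longrightarrow> False"
proof -
  let ?E = "edges G"
  obtain X0 where X0: "finite X0" "acyc (induced ?E (- X0))"
    using finite_cycle_hitting_set[OF G nm(1)] by blast
  obtain X where X: "finite X" "X0 \<subseteq> X" "class_connected ?E X"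
    using class_connected_hull[OF X0(1)] by metis
  have acX: "acyc (induced ?E (- X))"
    using X0(2) by (rule acyc_mono) (use X(2) in \<open>auto simp: induced_def\<close>)
  obtain Y1 where Y1: "finite Y1" "\<And>p q. p \<noteq> q \<Longrightarrow> (p, q) \<in> reach (induced ?E (- (X \<union> Y1))) \<Longrightarrow>
       adj ?E {p} X \<Longrightarrow> adj ?E {q} X \<Longrightarrow> False"
    using finite_ear_hitting_set[OF G nm(2) X(1,3)] by metis
  have "finite (X \<union> Y1)" using X(1) Y1(1) by simp
  then obtain Z where Z: "finite Z" "X \<union> Y1 \<subseteq> Z" "class_connected ?E Z"
    using class_connected_hull by metis
  let ?R = "reach (induced ?E (- Z))"
  have "False" if "p \<noteq> q" "(p, q) \<in> ?R" "adj ?E {p} X" "adj ?E {q} X" for p q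
    using Y1(2)[OF that(1) reach_induced_mono[OF that(2)] that(3,4)] Z(2) by blast
  then have att: "finite {p. p \<notin> Z \<and> (y, p) \<in> ?R \<and> adj ?E {p} Z}" for y
    using Z(1,2) acX by (intro finite_attachments[of X]) auto
  obtain Y2 where Y2: "finite Y2" "\<And>p q. p \<noteq> q \<Longrightarrow> (p, q) \<in> reach (induced ?E (- (Z \<union> Y2))) \<Longrightarrow>
       adj ?E {p} Z \<Longrightarrow> adj ?E {q} Z \<Longrightarrow> False"
    using finite_ear_hitting_set[OF G nm(2) Z(1,3)] by metis
  \<comment> \<open>The ends of ears of \<open>Z\<close>. There are finitely many: the component of such an end meets \<open>Y2\<close>.\<close>
  define A where "A = {p. p \<notin> Z \<and> adj ?E {p} Z \<and> (\<exists>q. q \<noteq> p \<and> (p, q) \<in> ?R \<and> adj ?E {q} Z)}"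
  have "A \<subseteq> (\<Union>y\<in>Y2. {p. p \<notin> Z \<and> (y, p) \<in> ?R \<and> adj ?E {p} Z})"
  proof
    fix p assume "p \<in> A"
    then obtain q where p: "p \<notin> Z" "adj ?E {p} Z" "q \<noteq> p" "(p, q) \<in> ?R" "adj ?E {q} Z"
      unfolding A_def by blast
    have "\<exists>y\<in>Y2. (y, p) \<in> ?R"
    proof (rule ccontr)
      assume no: "\<not> ?thesis"
      have "p \<notin> Y2" using no reach_refl[of p "induced ?E (- Z)"] by metis
      have eq: "induced (induced ?E (- Z)) (- Y2) = induced ?E (- (Z \<union> Y2))"
        by (auto simp: induced_def)
      consider "(p, q) \<in> reach (induced ?E (- (Z \<union> Y2)))"
        | p' y where "(p, p') \<in> reach (induced ?E (- (Z \<union> Y2)))" "{p', y} \<in> induced ?E (- Z)" "y \<in> Y2"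
        using reach_first_hit[OF p(4) \<open>p \<notin> Y2\<close>] unfolding eq by blast
      then show False
      proof cases
        case 1
        then show False using Y2(2)[OF p(3)[symmetric]] p(2,5) by blast
      next
        case 2
        have "(p, p') \<in> ?R" using 2(1) by (rule reach_induced_mono) auto
        then have "(y, p) \<in> ?R" using reach_edge[OF 2(2)] by (meson reach_sym reach_trans)
        then show False using no 2(3) by blast
      qed
    qed
    then show "p \<in> (\<Union>y\<in>Y2. {p. p \<notin> Z \<and> (y, p) \<in> ?R \<and> adj ?E {p} Z})" using p by blast
  qed
  then have "finite A" using att Y2(1) by (meson finite_UN_I finite_subset)
  \<comment> \<open>The hull is formed in \<open>G - Z\<close>, so that ends in the same component are connected outside \<open>Z\<close>.\<close>
  then obtain W where W: "finite W" "A \<subseteq> W" "class_connected (induced ?E (- Z)) W"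
      "W \<subseteq> A \<union> \<Union>(induced ?E (- Z))"
      "\<forall>w\<in>W. \<exists>a\<in>A. (w, a) \<in> reach (induced (induced ?E (- Z)) W)"
    by (rule class_connected_hull[where E = "induced ?E (- Z)"])
  have WZ: "W \<inter> Z = {}" using W(4) by (auto simp: A_def induced_def)
  let ?Z = "Z \<union> W"
  have near: "\<exists>z\<in>Z. (w, z) \<in> reach (induced ?E ?Z)" if w: "w \<in> ?Z" for w
  proof (cases "w \<in> Z")
    case False
    then obtain a where a: "a \<in> A" "(w, a) \<in> reach (induced (induced ?E (- Z)) W)"
      using w W(5) by blast
    then obtain z where z: "z \<in> Z" "{a, z} \<in> ?E" by (auto simp: A_def adj_singleton)
    have "(w, a) \<in> reach (induced ?E ?Z)" using a(2) by (rule reach_induced_mono) (auto simp: induced_def)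
    moreover have "(a, z) \<in> reach (induced ?E ?Z)"
      using z a(1) W(2) by (intro reach_edge) (auto simp: induced_def)
    ultimately show ?thesis using z(1) reach_trans by metis
  qed (use reach_refl[of w "induced ?E ?Z"] in blast)
  have "class_connected ?E ?Z"
    unfolding class_connected_def
  proof (intro ballI impI)
    fix w w' assume w: "w \<in> ?Z" "w' \<in> ?Z" "(w, w') \<in> reach ?E"
    obtain z z' where z: "z \<in> Z" "(w, z) \<in> reach (induced ?E ?Z)" "z' \<in> Z" "(w', z') \<in> reach (induced ?E ?Z)"
      using near w by meson
    have "(z, z') \<in> reach ?E" using w(3) z(2,4) reach_induced_D reach_sym reach_trans by metis
    then have "(z, z') \<in> reach (induced ?E Z)" using Z(3) z(1,3) unfolding class_connected_def by blast
    then have "(z, z') \<in> reach (induced ?E ?Z)" by (rule reach_induced_mono) auto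
    then show "(w, w') \<in> reach (induced ?E ?Z)" using z(2,4) reach_sym reach_trans by metis
  qed
  moreover have "acyc (induced ?E (- ?Z))"
    using acX by (rule acyc_mono) (use Z(2) in \<open>auto simp: induced_def\<close>)
  moreover have "False" if ne: "p \<noteq> q" and pq: "(p, q) \<in> reach (induced ?E (- ?Z))"
    and adj: "adj ?E {p} ?Z" "adj ?E {q} ?Z" for p q
  proof -
    have out: "p \<notin> ?Z" "q \<notin> ?Z" using reach_induced[OF pq] ne by auto
    have pqR: "(p, q) \<in> ?R" using pq by (rule reach_induced_mono) auto
    \<comment> \<open>A neighbour of \<open>Z\<close> in a component that meets \<open>W\<close> shares it with another end of an ear, so it is
      such an end itself and lies in \<open>W\<close>.\<close>
    have mixed: False
      if x: "x \<notin> ?Z" "adj ?E {x} Z" "(x, w) \<in> ?R" and w: "w \<in> W" for x w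
    proof -
      obtain a where a: "a \<in> A" "(w, a) \<in> reach (induced (induced ?E (- Z)) W)"
        using W(5) w by blast
      have "(x, a) \<in> ?R" using x(3) reach_induced_D[OF a(2)] by (rule reach_trans)
      moreover have "a \<noteq> x" using a(1) W(2) x(1) by blast
      moreover have "adj ?E {a} Z" using a(1) by (simp add: A_def)
      ultimately have "x \<in> A" using x(1,2) unfolding A_def by blast
      then show False using W(2) x(1) by blast
    qed
    have edgeR: "{x, w} \<in> induced ?E (- Z)" if "{x, w} \<in> ?E" "x \<notin> ?Z" "w \<in> W" for x w
      using that WZ by (auto simp: induced_def)
    obtain z z' where z: "z \<in> ?Z" "{p, z} \<in> ?E" "z' \<in> ?Z" "{q, z'} \<in> ?E"
      using adj by (auto simp: adj_singleton)
    consider "z \<in> Z" "z' \<in> Z" | "z \<in> Z" "z' \<in> W" | "z \<in> W" "z' \<in> Z" | "z \<in> W" "z' \<in> W"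
      using z by blast
    then show False
    proof cases
      case 1
      then have "p \<in> A" using z pqR ne out by (auto simp: A_def adj_singleton)
      then show False using W(2) out by blast
    next
      case 2
      have "(p, z') \<in> ?R" using pqR reach_edge[OF edgeR[OF z(4) out(2) 2(2)]] by (rule reach_trans)
      then show False using mixed[OF out(1) _ _ 2(2)] 2(1) z(2) by (auto simp: adj_singleton)
    next
      case 3
      have "(q, z) \<in> ?R" using reach_sym[OF pqR] reach_edge[OF edgeR[OF z(2) out(1) 3(1)]] by (rule reach_trans)
      then show False using mixed[OF out(2) _ _ 3(1)] 3(2) z(4) by (auto simp: adj_singleton)
    next
      \<comment> \<open>The path from \<open>p\<close> to \<open>q\<close> and a path inside \<open>W\<close> form a cycle in \<open>G - Z\<close>.\<close>
      case 4
      let ?E' = "induced ?E (- Z)"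
      have e: "{p, z} \<in> ?E'" "{q, z'} \<in> ?E'" using edgeR z(2,4) out 4 by blast+
      have "(z', z) \<in> ?R" using e pqR reach_edge reach_sym reach_trans by metis
      then have zz: "(z', z) \<in> reach (induced ?E' W)" using W(3) 4 unfolding class_connected_def by blast
      have ne': "p \<noteq> z" "q \<noteq> z" "p \<noteq> z'" using out 4 by auto
      have "(p, q) \<in> reach (?E' - {{p, z}})"
        using pq by (rule reach_mono) (use 4 in \<open>auto simp: induced_def\<close>)
      moreover have "(q, z') \<in> reach (?E' - {{p, z}})"
        using e(2) ne ne' by (intro reach_edge) (auto simp: doubleton_eq_iff)
      moreover have "(z', z) \<in> reach (?E' - {{p, z}})"
        using zz by (rule reach_mono) (use out in \<open>auto simp: induced_def\<close>)
      ultimately have "(p, z) \<in> reach (?E' - {{p, z}})" by (meson reach_trans)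
      moreover have "acyc ?E'"
        using acX by (rule acyc_mono) (use Z(2) in \<open>auto simp: induced_def\<close>)
      ultimately show False using acycD e(1) ne'(1) by metis
    qed
  qed
  ultimately show thesis using that[of ?Z] Z(1) W(1) by blast
qed

text \<open>A walk in the contracted graph lifts to \<open>G\<close> with the help of the contracted edges. If it avoids
  the edge \<open>{A, B}\<close>, its lift avoids all of the possibly many edges that are merged into \<open>{A, B}\<close>.\<close>

lemma reach_contracted_lift:
  assumes G: "simple_graph G" and F: "F \<subseteq> edges G" and AB: "A \<noteq> B"
    and r: "(reach F `` {u}, Q) \<in> reach (edges (contract_edges G F) - {{A, B}})"
    and w: "w \<in> Q"
  shows "(u, w) \<in> reach {e \<in> edges G. (\<lambda>v. reach F `` {v}) ` e \<noteq> {A, B}}"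
proof -
  let ?c = "\<lambda>v. reach F `` {v}"
  let ?M = "{e \<in> edges G. ?c ` e \<noteq> {A, B}}"
  have FM: "F \<subseteq> ?M"
  proof
    fix e assume e: "e \<in> F"
    then obtain x y where xy: "e = {x, y}"
      using F G by (metis card_2_iff simple_graph_def subsetD)
    then have "?c ` e = {?c x}" using reach_class_eq[of x y F] e by auto
    then show "e \<in> ?M" using e F AB by auto
  qed
  have "\<forall>w\<in>Q. (u, w) \<in> reach ?M"
    using r
  proof (induction rule: reach_induct)
    case refl
    show ?case using FM by (auto intro: reach_mono)
  next
    case (step P Q)
    obtain x y where xy: "{x, y} \<in> edges G" "P = ?c x" "Q = ?c y"
    proof -
      obtain x y where "{x, y} \<in> edges G" "{P, Q} = {?c x, ?c y}"
        using step(2) by (auto simp: contract_edges_def)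
      then show thesis using that[of x y] that[of y x] by (auto simp: doubleton_eq_iff insert_commute)
    qed
    show ?case
    proof
      fix w assume w: "w \<in> Q"
      have "x \<in> P" using xy(2) mem_reach_self by metis
      then have "(u, x) \<in> reach ?M" using step.IH by blast
      moreover have "(x, y) \<in> reach ?M" using xy step(2) by (intro reach_edge) auto
      moreover have "(y, w) \<in> reach ?M" using w xy(3) FM by (auto intro: reach_mono)
      ultimately show "(u, w) \<in> reach ?M" by (meson reach_trans)
    qed
  qed
  then show ?thesis using w by blast
qed

text \<open>Take an edge \<open>{A, B}\<close> of the contraction that is not a bridge and lift it to \<open>{a, b}\<close> together
  with the detour. Follow the detour from each end outside \<open>Z\<close> until it first reaches \<open>Z\<close>. If it never
  does, it closes a cycle in \<open>G - Z\<close>. Otherwise it leads to neighbours of \<open>Z\<close> joined outside \<open>Z\<close>; as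
  there are no ears, these coincide, which again yields a cycle outside \<open>Z\<close>, or an edge that is
  merged into \<open>{A, B}\<close> although the detour avoids those.\<close>

lemma acyc_contract_earless:
  assumes G: "simple_graph G" and cc: "class_connected (edges G) Z"
    and ac: "acyc (induced (edges G) (- Z))"
    and ear: "\<And>p q. p \<noteq> q \<Longrightarrow> (p, q) \<in> reach (induced (edges G) (- Z)) \<Longrightarrow>
       adj (edges G) {p} Z \<Longrightarrow> adj (edges G) {q} Z \<Longrightarrow> False"
  shows "acyc (edges (contract_edges G (induced (edges G) Z)))"
  unfolding acyc_def
proof (intro allI impI notI)
  let ?E = "edges G" and ?N = "induced (edges G) (- Z)"
  define F where "F = induced ?E Z"
  let ?c = "\<lambda>v. reach F `` {v}"
  fix A B
  assume AB: "{A, B} \<in> edges (contract_edges G (induced ?E Z))" "A \<noteq> B"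
    "(A, B) \<in> reach (edges (contract_edges G (induced ?E Z)) - {{A, B}})"
  obtain a b where ab: "{a, b} \<in> ?E" "A = ?c a" "B = ?c b"
  proof -
    obtain a b where "{a, b} \<in> ?E" "{A, B} = {?c a, ?c b}"
      using AB(1) by (auto simp: contract_edges_def F_def)
    then show thesis using that[of a b] that[of b a] by (auto simp: doubleton_eq_iff insert_commute)
  qed
  \<comment> \<open>all edges except those merged into \<open>{A, B}\<close>\<close>
  define M where "M = {e \<in> ?E. ?c ` e \<noteq> {A, B}}"
  have FE: "F \<subseteq> ?E" by (auto simp: F_def induced_def)
  have "(?c a, B) \<in> reach (edges (contract_edges G F) - {{A, B}})"
    using AB(3) unfolding F_def[symmetric] ab(2)[symmetric] .
  moreover have "b \<in> B" using mem_reach_self[of b F] unfolding ab(3)[symmetric] .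
  ultimately have abM: "(a, b) \<in> reach M"
    unfolding M_def by (rule reach_contracted_lift[OF G FE AB(2)])
  have sameZ: "?c x = ?c y" if "x \<in> Z" "y \<in> Z" "(x, y) \<in> reach ?E" for x y
    using cc that unfolding class_connected_def F_def reach_class_eq_iff by blast
  \<comment> \<open>An edge \<open>{x, y}\<close> leaving \<open>Z\<close>: the detour from \<open>y\<close> can enter \<open>Z\<close> only directly from \<open>y\<close>, by an
    edge parallel to \<open>{x, y}\<close> in the contraction.\<close>
  have mixed: False
    if x: "x \<in> Z" "y \<notin> Z" "{x, y} \<in> ?E" "(y, x) \<in> reach M" "{?c x, ?c y} = {A, B}" for x y
  proof -
    have adjy: "adj ?E {y} Z" using x(1,3) by (auto simp: adj_singleton insert_commute)
    have "(y, x) \<notin> reach (induced M (- Z))"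
      using reach_induced[of y x M "- Z"] x(1,2) by auto
    with reach_first_hit[OF x(4,2)] obtain q z
      where q: "(y, q) \<in> reach (induced M (- Z))" "{q, z} \<in> M" "z \<in> Z"
      by metis
    have yq: "(y, q) \<in> reach ?N" using q(1) by (rule reach_induced_mono) (auto simp: M_def)
    have "adj ?E {q} Z" using q(2,3) by (auto simp: adj_singleton M_def)
    then have "y = q" using ear[OF _ yq adjy] by blast
    then have yz: "{y, z} \<in> ?E" "{?c y, ?c z} \<noteq> {A, B}" using q(2) by (auto simp: M_def)
    have "(x, z) \<in> reach ?E" using x(3) yz(1) reach_edge reach_trans by metis
    then show False using sameZ[OF x(1) q(3)] x(5) yz(2) by (simp add: insert_commute)
  qed
  consider "a \<in> Z" "b \<in> Z" | "a \<in> Z" "b \<notin> Z" | "a \<notin> Z" "b \<in> Z" | "a \<notin> Z" "b \<notin> Z" by blast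
  then show False
  proof cases
    case 1
    then show False using sameZ[of a b] reach_edge[OF ab(1)] AB(2) ab(2,3) by simp
  next
    case 2
    show False using mixed[OF 2 ab(1) reach_sym[OF abM]] ab(2,3) by simp
  next
    case 3
    show False using mixed[OF 3(2,1) _ abM] ab by (simp add: insert_commute)
  next
    case 4
    have ne: "a \<noteq> b" using AB(2) ab(2,3) by blast
    have "{a, b} \<notin> M" unfolding M_def ab(2,3) by simp
    moreover have "M \<subseteq> ?E" unfolding M_def by (rule Collect_restrict)
    ultimately have MN: "induced M (- Z) \<subseteq> ?N - {{a, b}}" unfolding induced_def by blast
    have abN: "{a, b} \<in> ?N" using ab(1) 4 by (simp add: induced_def)
    have noN: "(a, b) \<notin> reach (?N - {{a, b}})"
      by (rule notI) (rule acycD[OF ac abN ne])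
    have no: "(a, b) \<notin> reach (induced M (- Z))" 
      by (rule notI) (rule notE[OF noN reach_mono[OF _ MN]])
    obtain p z where p: "(a, p) \<in> reach (induced M (- Z))" "{p, z} \<in> M" "z \<in> Z"
      using reach_first_hit[OF abM 4(1)] no by metis
    obtain q z' where q: "(b, q) \<in> reach (induced M (- Z))" "{q, z'} \<in> M" "z' \<in> Z"
      using reach_first_hit[OF reach_sym[OF abM] 4(2)] no reach_sym[of b a] by metis
    note ap = reach_mono[OF p(1) MN] and bq = reach_mono[OF q(1) MN]
    have "p \<noteq> q"
    proof
      assume "p = q"
      then have "(b, p) \<in> reach (?N - {{a, b}})" using bq by (simp only:)
      then have "(a, b) \<in> reach (?N - {{a, b}})" by (rule reach_trans[OF ap reach_sym])
      then show False using noN by contradiction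
    qed
    moreover have "(p, q) \<in> reach ?N"
    proof (rule reach_trans)
      show "(p, a) \<in> reach ?N" by (rule reach_sym[OF reach_mono[OF ap Diff_subset]])
      have "(b, q) \<in> reach ?N" by (rule reach_mono[OF bq Diff_subset])
      then show "(a, q) \<in> reach ?N" by (rule reach_trans[OF reach_edge[OF abN]])
    qed
    moreover have "adj ?E {p} Z" "adj ?E {q} Z"
      using p(2,3) q(2,3) unfolding adj_singleton M_def by blast+
    ultimately show False by (rule ear)
  qed
qed

lemma Forb_subset_fin_contract:
  "(Forb {omega_K3, vee_K3} :: 'a graph set) \<subseteq> fin_contract forests"
proof
  fix G :: "'a graph"
  assume "G \<in> Forb {omega_K3, vee_K3}"
  then have G: "countable_graph G" and nm: "\<not> is_minor omega_K3 G" "\<not> is_minor vee_K3 G"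
    by (auto simp: Forb_def)
  have s: "simple_graph G" using G by (simp add: countable_graph_def)
  obtain Z where Z: "finite Z" "class_connected (edges G) Z" "acyc (induced (edges G) (- Z))"
    "\<And>p q. p \<noteq> q \<Longrightarrow> (p, q) \<in> reach (induced (edges G) (- Z)) \<Longrightarrow>
       adj (edges G) {p} Z \<Longrightarrow> adj (edges G) {q} Z \<Longrightarrow> False"
    using finite_earless_set[OF s nm] by metis
  let ?F = "induced (edges G) Z"
  have "?F \<subseteq> Pow Z" "?F \<subseteq> edges G" by (auto simp: induced_def)
  moreover from this have "finite ?F" using Z(1) by (meson finite_Pow_iff finite_subset)
  moreover have "contract_edges G ?F \<in> forests"
    using acyc_contract_earless[OF s Z(2-4)] countable_graph_contract[OF G]
    by (simp add: forests_iff_acyc)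
  ultimately show "G \<in> fin_contract forests" using G by (auto simp: fin_contract_def)
qed

lemma delete_edges_empty: "delete_edges G {} = G"
  by (cases G) (simp add: delete_edges_def)

lemma fin_contract_subset_fin_delete_contract:
  "fin_contract forests \<subseteq> fin_delete_contract forests"
proof -
  have "(forests :: 'b graph set) \<subseteq> fin_delete forests"
  proof
    fix G :: "'b graph"
    assume "G \<in> forests"
    then show "G \<in> fin_delete forests"
      unfolding fin_delete_def
      by (auto simp: delete_edges_empty forests_iff_acyc intro!: exI[of _ "{}"])
  qed
  then show ?thesis by (auto simp: fin_delete_contract_def fin_contract_def)
qed

theorem proposition8p1:
  shows "fin_contract forests = (Forb {omega_K3, vee_K3} :: 'a graph set)
    \<and> (Forb {omega_K3, vee_K3} :: 'a graph set) = fin_delete_contract forests"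
  using fin_delete_contract_subset_Forb Forb_subset_fin_contract
    fin_contract_subset_fin_delete_contract by blast

end
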